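(* Let $q$ be a prime power and let $k,m,t$ be positive integers with $m+t+2\le k$. Let $W$ be a fixed $(t-1)$-dimensional subspace of $\mathbb{F}_q^k$. The caching line graph $\mathcal{L}$ constructed from $(k,m,t,q,W)$ as described in the context corresponds to a D2D coded caching scheme with the following parameters; that is, there exists a D2D coded caching scheme with number of users $K^{\mathcal{D}}=|\mathbb{X}|$, subpacketization $F^{\mathcal{D}}$, cached fraction $\frac{M^{\mathcal{D}}}{N^{\mathcal{D}}}$ and rate $R^{\mathcal{D}}$ given by $$K^{\mathcal{D}}=\frac{q}{2}\begin{bmatrix}k-t+1\\ 1\end{bmatrix}_q\begin{bmatrix}k-t\\ 1\end{bmatrix}_q,$$ $$F^{\mathcal{D}}=\frac{(m+1)(m+4)}{2}\begin{bmatrix}k-t+1\\ m+1\end{bmatrix}_q\frac{\prod_{i=0}^{m}(q^{m+1}-q^{i})}{(m+1)!\,(q-1)^{m+1}},$$ $$\frac{M^{\mathcal{D}}}{N^{\mathcal{D}}}=1-q^{2(m+1)}\,\frac{\begin{bmatrix}k-m-t\\ 1\end{bmatrix}_q\begin{bmatrix}k-m-t-1\\ 1\end{bmatrix}_q}{\begin{bmatrix}k-t+1\\ 1\end{bmatrix}_q\begin{bmatrix}k-t\\ 1\end{bmatrix}_q},$$ $$R^{\mathcal{D}}=\frac{q^{2m+3}}{(m+1)(m+4)}\begin{bmatrix}k-m-t\\ 1\end{bmatrix}_q\begin{bmatrix}k-m-t-1\\ 1\end{bmatrix}_q.$$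
   Context: **$q$-binomial coefficients.** For integers $a\ge b\ge 1$, $\begin{bmatrix}a\\ b\end{bmatrix}_q=\frac{(q^a-1)(q^{a-1}-1)\cdots(q^{a-b+1}-1)}{(q^b-1)(q^{b-1}-1)\cdots(q-1)}$; $\begin{bmatrix}a\\ 0\end{bmatrix}_q=1$. **Construction of $\mathcal{L}$.** All subspaces are subspaces of $\mathbb{F}_q^k$, and sums of subspaces are the usual subspace sums. Let $\mathbb{V}$, $\mathbb{R}$, $\mathbb{S}$, $\mathbb{U}$ be the sets of subspaces containing $W$ of dimension $t$, $t+1$, $m+t$, $m+t+2$ respectively. Let $\mathbb{X}=\{\{V_1,V_2\}: V_1,V_2\in\mathbb{V},\ V_1+V_2\in\mathbb{R}\}$ and $\mathbb{Y}=\{\{V_1,\dots,V_{m+1}\}: V_i\in\mathbb{V}\ \forall i,\ \sum_{i=1}^{m+1}V_i\in\mathbb{S}\}$. The vertex set of $\mathcal{L}$ is $V(\mathcal{L})=\{(X,Y)\in\mathbb{X}\times\mathbb{Y}:\ \sum_{V\in X}V+\sum_{V\in Y}V\in\mathbb{U}\}$, and two distinct vertices $(X,Y),(X',Y')$ are adjacent iff $X=X'$ or $Y=Y'$. **Placement delivery arrays (PDAs).** An $F\times K$ array with entries in $\{*\}\cup\{1,\dots,S\}$ is a $(K,F,Z,S)$ PDA if each column contains exactly $Z$ symbols $*$, each integer $1,\dots,S$ occurs at least once, and any two distinct entries $a_{j_1,k_1}=a_{j_2,k_2}$ equal to the same integer satisfy $j_1\ne j_2$, $k_1\neq k_2$ and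 $a_{j_1,k_2}=a_{j_2,k_1}=*$. It is a $g$-$(K,F,Z,S)$ regular PDA if each integer occurs exactly $g$ times. The correspondence between $\mathcal{L}$ and D2D schemes is via the array with columns indexed by $\mathbb{X}$ and rows indexed by $\mathbb{Y}$, having $*$ in position $(Y,X)$ iff $(X,Y)\notin V(\mathcal{L})$, the integers labelling the cliques in a partition of $V(\mathcal{L})$ into cliques of size $d=\binom{m+3}{2}$ of $\overline{\mathcal{L}^2}$ (the complement of the square of $\mathcal{L}$), and via the following known result from the literature: for every $g$-$(K,F,Z,S)$ regular PDA with $g\ge2$ there is a D2D coded caching scheme with $K^{\mathcal{D}}=K$, $\frac{M^{\mathcal{D}}}{N^{\mathcal{D}}}=\frac{Z}{F}$, $R^{\mathcal{D}}=\frac{g}{g-1}\frac{S}{F}$ and $F^{\mathcal{D}}=(g-1)F$. **D2D coded caching.** There is a library of $N^{\mathcal{D}}$ files and $K^{\mathcal{D}}$ users, each with a cache that can store (the equivalent of) $M^{\mathcal{D}}$ files; there is no central server. Each file is divided into $F^{\mathcal{D}}$ equal-sized subfiles (taking values in an Abelian group). In the caching phase, each user's cache is filled with library content, before demands are known. In the transmission phase each user demands one file of the library, and the demands are known to all users. Each user $l$, as a function of its own cache contents and the demands, makes an error-free multicast transmission to all other users consisting of coded subfiles; its rate $r_l$ is the number of coded subfiles (each of the size of one subfile) it transmits divided by $F^{\mathcal{D}}$. For every choice of demands, each user must recover its demanded file from its own cache and the transmissions of the other users. The cached fraction is $\frac{M^{\mathcal{D}}}{N^{\mathcal{D}}}$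 and the rate is $R^{\mathcal{D}}=\sum_{l=1}^{K^{\mathcal{D}}}r_l$. *)

theory Defs
  imports
    "HOL-Analysis.Analysis"
    "HOL-Library.Set_Algebras"
    "HOL-Library.Disjoint_Sets"
begin

section \<open>Gaussian binomial coefficients\<close>

definition qbinom :: "nat \<Rightarrow> nat \<Rightarrow> nat \<Rightarrow> real" where
  "qbinom q a b = (\<Prod>i<b. real q ^ (a - i) - 1) / (\<Prod>i<b. real q ^ (b - i) - 1)"


section \<open>Simple graphs, their squares and complements\<close>

record 'v sgraph =
  verts :: "'v set"
  adj :: "'v \<Rightarrow> 'v \<Rightarrow> bool"

text \<open>Two distinct vertices are adjacent in the square iff their distance is at most 2.\<close>

definition square_graph :: "'v sgraph \<Rightarrow> 'v sgraph" where
  "square_graph G = \<lparr> verts = verts G,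
     adj = (\<lambda>u v. u \<in> verts G \<and> v \<in> verts G \<and> u \<noteq> v \<and>
       (adj G u v \<or> (\<exists>w\<in>verts G. adj G u w \<and> adj G w v))) \<rparr>"

definition complement_graph :: "'v sgraph \<Rightarrow> 'v sgraph" where
  "complement_graph G = \<lparr> verts = verts G,
     adj = (\<lambda>u v. u \<in> verts G \<and> v \<in> verts G \<and> u \<noteq> v \<and> \<not> adj G u v) \<rparr>"

definition is_clique :: "'v sgraph \<Rightarrow> 'v set \<Rightarrow> bool" where
  "is_clique G C \<longleftrightarrow> C \<subseteq> verts G \<and> (\<forall>u\<in>C. \<forall>v\<in>C. u \<noteq> v \<longrightarrow> adj G u v)"


section \<open>The caching line graph of a subspace\<close>

text \<open>Sums of subspaces are elementwise sums of sets, and finite sums of families of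
  subspaces are taken with respect to this addition.\<close>

definition subspaces_above :: "('a::field ^ 'n) set \<Rightarrow> nat \<Rightarrow> ('a ^ 'n) set set" where
  "subspaces_above W d = {V. vec.subspace V \<and> W \<subseteq> V \<and> vec.dim V = d}"

definition set_X :: "('a::field ^ 'n) set \<Rightarrow> nat \<Rightarrow> ('a ^ 'n) set set set" where
  "set_X W t = {{V1, V2} | V1 V2.
     V1 \<in> subspaces_above W t \<and> V2 \<in> subspaces_above W t \<and>
     V1 + V2 \<in> subspaces_above W (t + 1)}"

definition set_Y :: "('a::field ^ 'n) set \<Rightarrow> nat \<Rightarrow> nat \<Rightarrow> ('a ^ 'n) set set set" where
  "set_Y W m t = {V ` {1..m+1} | V.
     (\<forall>i\<in>{1..m+1}. V i \<in> subspaces_above W t) \<and>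
     (\<Sum>i=1..m+1. V i) \<in> subspaces_above W (m + t)}"

definition caching_line_graph ::
  "('a::field ^ 'n) set \<Rightarrow> nat \<Rightarrow> nat \<Rightarrow> (('a ^ 'n) set set \<times> ('a ^ 'n) set set) sgraph" where
  "caching_line_graph W m t =
    (let VL = {(X, Y) \<in> set_X W t \<times> set_Y W m t.
                (\<Sum>V\<in>X. V) + (\<Sum>V\<in>Y. V) \<in> subspaces_above W (m + t + 2)}
     in \<lparr> verts = VL,
          adj = (\<lambda>u v. u \<in> VL \<and> v \<in> VL \<and> u \<noteq> v \<and> (fst u = fst v \<or> snd u = snd v)) \<rparr>)"


section \<open>Placement delivery arrays\<close>

text \<open>The entry of the array \<open>A\<close> in row \<open>j\<close> and column \<open>k\<close> is \<open>A j k\<close>, where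
  \<open>None\<close> stands for the symbol \<open>*\<close>.\<close>

definition is_PDA ::
  "'r set \<Rightarrow> 'c set \<Rightarrow> ('r \<Rightarrow> 'c \<Rightarrow> nat option) \<Rightarrow> nat \<Rightarrow> nat \<Rightarrow> nat \<Rightarrow> nat \<Rightarrow> bool" where
  "is_PDA Rs Cs A K F Z S \<longleftrightarrow>
     finite Rs \<and> card Rs = F \<and> finite Cs \<and> card Cs = K \<and>
     (\<forall>j\<in>Rs. \<forall>k\<in>Cs. A j k \<in> insert None (Some ` {1..S})) \<and>
     (\<forall>k\<in>Cs. card {j\<in>Rs. A j k = None} = Z) \<and>
     (\<forall>s\<in>{1..S}. \<exists>j\<in>Rs. \<exists>k\<in>Cs. A j k = Some s) \<and>
     (\<forall>j1\<in>Rs. \<forall>k1\<in>Cs. \<forall>j2\<in>Rs. \<forall>k2\<in>Cs. \<forall>s.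
        (j1, k1) \<noteq> (j2, k2) \<and> A j1 k1 = Some s \<and> A j2 k2 = Some s \<longrightarrow>
        j1 \<noteq> j2 \<and> k1 \<noteq> k2 \<and> A j1 k2 = None \<and> A j2 k1 = None)"

definition is_regular_PDA ::
  "nat \<Rightarrow> 'r set \<Rightarrow> 'c set \<Rightarrow> ('r \<Rightarrow> 'c \<Rightarrow> nat option) \<Rightarrow> nat \<Rightarrow> nat \<Rightarrow> nat \<Rightarrow> nat \<Rightarrow> bool" where
  "is_regular_PDA g Rs Cs A K F Z S \<longleftrightarrow>
     is_PDA Rs Cs A K F Z S \<and>
     (\<forall>s\<in>{1..S}. card {(j, k) \<in> Rs \<times> Cs. A j k = Some s} = g)"

definition clique_array ::
  "('c \<times> 'r) sgraph \<Rightarrow> ('c \<times> 'r) set set \<Rightarrow> (('c \<times> 'r) set \<Rightarrow> nat) \<Rightarrow> 'r \<Rightarrow> 'c \<Rightarrow> nat option" where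
  "clique_array L P lab y x =
     (if (x, y) \<in> verts L then Some (lab (THE C. C \<in> P \<and> (x, y) \<in> C)) else None)"


section \<open>D2D coded caching schemes\<close>

text \<open>Users are \<open>{..<num_users s}\<close>, files are \<open>{..<num_files s}\<close>, and a library
  \<open>w :: nat \<times> nat \<Rightarrow> 'g\<close> gives the value \<open>w (n, f)\<close> of subfile \<open>f < subpack s\<close> of file \<open>n\<close>.
  The number \<open>memory s\<close> is the cache size in units of files. The set \<open>cache s l\<close> consists of the
  subfiles stored by user \<open>l\<close>; it does not depend on the demands. For a demand vector \<open>d\<close>
  and cache contents \<open>z\<close> of user \<open>l\<close>, the coded subfiles sent by \<open>l\<close> are
  \<open>transmit s l d z i\<close> with \<open>i < num_coded s l\<close>. Finally \<open>decode s l d z r f\<close> is the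
  estimate of subfile \<open>f\<close> of the demanded file computed by user \<open>l\<close> from its cache contents
  \<open>z\<close> and the received coded subfiles \<open>r (j, i)\<close>.\<close>

record 'g d2d_scheme =
  num_users :: nat
  num_files :: nat
  subpack :: nat
  memory :: real
  cache :: "nat \<Rightarrow> (nat \<times> nat) set"
  num_coded :: "nat \<Rightarrow> nat"
  transmit :: "nat \<Rightarrow> (nat \<Rightarrow> nat) \<Rightarrow> (nat \<times> nat \<Rightarrow> 'g) \<Rightarrow> nat \<Rightarrow> 'g"
  decode :: "nat \<Rightarrow> (nat \<Rightarrow> nat) \<Rightarrow> (nat \<times> nat \<Rightarrow> 'g) \<Rightarrow> (nat \<times> nat \<Rightarrow> 'g) \<Rightarrow> nat \<Rightarrow> 'g"

text \<open>Restricting a function to \<open>cache s l\<close>, or to the indices of the transmissions of the other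
  users, makes it carry exactly the information that is available to user \<open>l\<close>.\<close>

definition cache_content :: "'g d2d_scheme \<Rightarrow> (nat \<times> nat \<Rightarrow> 'g) \<Rightarrow> nat \<Rightarrow> (nat \<times> nat \<Rightarrow> 'g)" where
  "cache_content s w l = restrict w (cache s l)"

definition received ::
  "'g d2d_scheme \<Rightarrow> (nat \<times> nat \<Rightarrow> 'g) \<Rightarrow> (nat \<Rightarrow> nat) \<Rightarrow> nat \<Rightarrow> (nat \<times> nat \<Rightarrow> 'g)" where
  "received s w d l =
     restrict (\<lambda>(j, i). transmit s j d (cache_content s w j) i)
       {(j, i). j < num_users s \<and> j \<noteq> l \<and> i < num_coded s j}"

definition is_d2d_scheme :: "'g::ab_group_add d2d_scheme \<Rightarrow> bool" where
  "is_d2d_scheme s \<longleftrightarrow>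
     num_users s > 0 \<and> num_files s > 0 \<and> subpack s > 0 \<and>
     (\<forall>l<num_users s. cache s l \<subseteq> {..<num_files s} \<times> {..<subpack s} \<and>
        real (card (cache s l)) \<le> memory s * real (subpack s)) \<and>
     (\<forall>w. \<forall>d \<in> {..<num_users s} \<rightarrow>\<^sub>E {..<num_files s}. \<forall>l<num_users s. \<forall>f<subpack s.
        decode s l d (cache_content s w l) (received s w d l) f = w (d l, f))"

definition cached_fraction :: "'g d2d_scheme \<Rightarrow> real" where
  "cached_fraction s = memory s / real (num_files s)"

definition user_rate :: "'g d2d_scheme \<Rightarrow> nat \<Rightarrow> real" where
  "user_rate s l = real (num_coded s l) / real (subpack s)"

definition d2d_rate :: "'g d2d_scheme \<Rightarrow> real" where
  "d2d_rate s = (\<Sum>l<num_users s. user_rate s l)"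

text \<open>A graph on a subset of \<open>Cs \<times> Rs\<close> corresponds to a D2D scheme if its vertices are
  partitioned into cliques of size \<open>g\<close> of the complement of its square such that the array
  obtained by labelling the cliques with integers is a \<open>g\<close>-regular PDA, and the scheme
  has the parameters that D2D schemes obtained from \<open>g\<close>-regular PDAs have.\<close>

definition corresponds_to_d2d ::
  "('c \<times> 'r) sgraph \<Rightarrow> 'c set \<Rightarrow> 'r set \<Rightarrow> nat \<Rightarrow> 'g::ab_group_add d2d_scheme \<Rightarrow> bool" where
  "corresponds_to_d2d L Cs Rs g s \<longleftrightarrow>
     is_d2d_scheme s \<and> g \<ge> 2 \<and>
     (\<exists>P lab K F Z S.
        partition_on (verts L) P \<and>
        (\<forall>C\<in>P. is_clique (complement_graph (square_graph L)) C \<and> card C = g) \<and>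
        bij_betw lab P {1..S} \<and>
        is_regular_PDA g Rs Cs (clique_array L P lab) K F Z S \<and>
        num_users s = K \<and>
        cached_fraction s = real Z / real F \<and>
        d2d_rate s = real g / real (g - 1) * (real S / real F) \<and>
        subpack s = (g - 1) * F)"

end

theory Submission
  imports Defs
begin

text \<open>Modulo \<open>W\<close> the elements of \<open>subspaces_above W t\<close> are the points of a projective space, and
  the vertices of the graph are the pairs of a 2-set and an (\<open>m\<close> + 1)-set of points that are disjoint
  and jointly independent. For a fixed independent set \<open>Z\<close> of \<open>m + 3\<close> points, the pairs
  \<open>(X, Z - X)\<close> form a clique of the complement of the square, because the first part of each pair
  meets the second part of every other one; these cliques partition the vertices. All parameters
  are then numbers of independent sets, which follow from the fact that the number of points that
  extend an independent set depends only on its size. In the scheme of a \<open>g\<close>-regular array every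
  packet is split into \<open>g - 1\<close> pieces, one for each of the other \<open>g - 1\<close> users that share its
  integer.\<close>

section \<open>From regular placement delivery arrays to D2D schemes\<close>

lemma sum_card_swap:
  assumes "finite A" "finite B"
  shows "(\<Sum>a\<in>A. card {b\<in>B. R a b}) = (\<Sum>b\<in>B. card {a\<in>A. R a b})"
proof -
  have "(\<Sum>a\<in>A. card {b\<in>B. R a b}) = (\<Sum>a\<in>A. \<Sum>b\<in>B. if R a b then 1 else 0)"
    using assms by (intro sum.cong refl) (simp add: sum.If_cases Int_def)
  also have "\<dots> = (\<Sum>b\<in>B. \<Sum>a\<in>A. if R a b then 1 else 0)"
    by (rule sum.swap)
  also have "\<dots> = (\<Sum>b\<in>B. card {a\<in>A. R a b})"
    using assms by (intro sum.cong refl) (simp add: sum.If_cases Int_def)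
  finally show ?thesis .
qed

lemma div_less_of_less_mult:
  fixes f n k :: nat
  assumes "f < n * k"
  shows "f div n < k"
  using assms by (simp add: less_mult_imp_div_less mult.commute)

text \<open>Among the users that share an integer, each wants one packet that all the others have
  cached. Each of these \<open>g\<close> users sends the sum of one piece for every other one, and a
  receiver cancels all summands but its own. That makes \<open>g * S\<close> transmissions, each of
  size \<open>1 / ((g - 1) * F)\<close> of a file.\<close>

lemma d2d_scheme_of_nat_PDA:
  fixes B :: "nat \<Rightarrow> nat \<Rightarrow> nat option"
  assumes reg: "is_regular_PDA g {..<F} {..<K} B K F Z S"
    and g: "g \<ge> 2" and F: "F > 0" and K: "K > 0" and N: "N \<ge> 1"
  shows "\<exists>s :: 'g::ab_group_add d2d_scheme. is_d2d_scheme s \<and> num_files s = N \<and> num_users s = K \<and>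
    cached_fraction s = real Z / real F \<and>
    d2d_rate s = real g / real (g - 1) * (real S / real F) \<and> subpack s = (g - 1) * F"
proof -
  define h where "h = g - 1"
  have h: "h > 0" using g by (simp add: h_def)
  note pda = reg[unfolded is_regular_PDA_def is_PDA_def]
  have ent: "s \<in> {1..S}" if "B j l = Some s" "j < F" "l < K" for j l s
    using pda that by (metis (no_types, lifting) imageE insertE lessThan_iff option.distinct(1) option.inject)
  have star: "card {j\<in>{..<F}. B j l = None} = Z" if "l < K" for l
    using that pda by simp
  have same: "j1 \<noteq> j2 \<and> k1 \<noteq> k2 \<and> B j1 k2 = None \<and> B j2 k1 = None"
    if "B j1 k1 = Some s" "B j2 k2 = Some s" "j1 < F" "j2 < F" "k1 < K" "k2 < K" "(j1,k1) \<noteq> (j2,k2)"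
    for j1 k1 j2 k2 s
  proof -
    from pda have "\<forall>j1\<in>{..<F}. \<forall>k1\<in>{..<K}. \<forall>j2\<in>{..<F}. \<forall>k2\<in>{..<K}. \<forall>s.
        (j1, k1) \<noteq> (j2, k2) \<and> B j1 k1 = Some s \<and> B j2 k2 = Some s \<longrightarrow>
        j1 \<noteq> j2 \<and> k1 \<noteq> k2 \<and> B j1 k2 = None \<and> B j2 k1 = None" by (elim conjE)
    from this[rule_format, of j1 k1 j2 k2 s] show ?thesis using that by simp
  qed
  have gcard: "card {(j, k) \<in> {..<F} \<times> {..<K}. B j k = Some s} = g" if "s \<in> {1..S}" for s
    using that pda by blast
  \<comment> \<open>The users that share the integer \<open>s\<close>; user \<open>l \<in> G s\<close> wants the packet in row \<open>\<rho> s l\<close>, whose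
    \<open>p\<close>-th piece is sent by user \<open>e s l p\<close>. The \<open>i\<close>-th transmission of user \<open>k\<close> serves the
    integer \<open>\<tau> k i\<close>, and subfile \<open>j * h + p\<close> is the \<open>p\<close>-th piece of packet \<open>j\<close>.\<close>
  define G where "G s = {l. l < K \<and> (\<exists>j<F. B j l = Some s)}" for s
  define \<rho> where "\<rho> s l = (SOME j. j < F \<and> B j l = Some s)" for s l
  have \<rho>: "\<rho> s l < F \<and> B (\<rho> s l) l = Some s" if "l \<in> G s" for s l
    using that someI_ex[of "\<lambda>j. j < F \<and> B j l = Some s"] by (auto simp: \<rho>_def G_def)
  \<comment> \<open>An integer occurs at most once in a column, so the choice in
    \<open>\<rho>\<close> is forced.\<close>
  have \<rho>_eq: "\<rho> s l = j" if "j < F" "l < K" "B j l = Some s" for s l j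
    using same[of "\<rho> s l" l s j l] \<rho>[of l s] that by (auto simp: G_def)
  have finG: "finite (G s)" for s by (simp add: G_def)
  have Gle: "l < K" if "l \<in> G s" for l s using that by (simp add: G_def)
  have cardG: "card (G s) = g" if "s \<in> {1..S}" for s
  proof -
    have "{(j, k) \<in> {..<F} \<times> {..<K}. B j k = Some s} = (\<lambda>l. (\<rho> s l, l)) ` G s"
    proof (intro subset_antisym subsetI)
      fix u assume "u \<in> {(j, k) \<in> {..<F} \<times> {..<K}. B j k = Some s}"
      then obtain j k where u: "u = (j, k)" "j < F" "k < K" "B j k = Some s" by auto
      then have "k \<in> G s" by (auto simp: G_def)
      then show "u \<in> (\<lambda>l. (\<rho> s l, l)) ` G s" using u \<rho>_eq[OF u(2-4)]
        by (intro image_eqI[of _ _ k]) simp_all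
    next
      fix u assume "u \<in> (\<lambda>l. (\<rho> s l, l)) ` G s"
      then obtain l where "l \<in> G s" "u = (\<rho> s l, l)" by auto
      then show "u \<in> {(j, k) \<in> {..<F} \<times> {..<K}. B j k = Some s}"
        using \<rho>[of l s] Gle[of l s] by simp
    qed
    moreover have "inj_on (\<lambda>l. (\<rho> s l, l)) (G s)" by (auto intro: inj_onI)
    ultimately show ?thesis using gcard[OF that] by (simp add: card_image)
  qed
  \<comment> \<open>The star condition of the array: every other user that shares the integer has
    cached the packet wanted by \<open>l\<close>.\<close>
  have Gnone: "B (\<rho> s l) k = None" if "l \<in> G s" "k \<in> G s" "k \<noteq> l" for s l k
    using same[of "\<rho> s l" l s "\<rho> s k" k] \<rho> Gle that by auto
  have GS: "s \<in> {1..S}" if "l \<in> G s" for s l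
    using that ent unfolding G_def by blast
  define e where "e s l = (SOME e. bij_betw e {..<h} (G s - {l}))" for s l
  have e: "bij_betw (e s l) {..<h} (G s - {l})" if "l \<in> G s" for s l
  proof -
    have "card (G s - {l}) = h" using that finG cardG[OF GS[OF that]] by (simp add: h_def)
    then have "\<exists>e. bij_betw e {..<h} (G s - {l})"
      using finG ex_bij_betw_nat_finite[of "G s - {l}"] by (auto simp: atLeast0LessThan)
    then show ?thesis unfolding e_def by (rule someI_ex)
  qed
  \<comment> \<open>\<open>e' s l k\<close> is the index of the piece that user \<open>k\<close>
    contributes to user \<open>l\<close>.\<close>
  define e' where "e' s l = the_inv_into {..<h} (e s l)" for s l
  have e'lt: "e' s l k < h" if "l \<in> G s" "k \<in> G s" "k \<noteq> l" for s l k
    using the_inv_into_into[of "e s l" "{..<h}" k "{..<h}"] e[OF that(1)] that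
    by (auto simp: e'_def bij_betw_def)
  have e'e: "e' s l (e s l p) = p" if "l \<in> G s" "p < h" for s l p
    using e[OF that(1)] that by (simp add: e'_def bij_betw_def the_inv_into_f_f)
  have eG: "e s l p \<in> G s \<and> e s l p \<noteq> l" if "l \<in> G s" "p < h" for s l p
    using e[OF that(1)] that by (auto simp: bij_betw_def)
  define Ss where "Ss l = {s\<in>{1..S}. l \<in> G s}" for l
  have finS: "finite (Ss l)" for l by (simp add: Ss_def)
  define \<tau> where "\<tau> l = (SOME \<tau>. bij_betw \<tau> {..<card (Ss l)} (Ss l))" for l
  have \<tau>: "bij_betw (\<tau> l) {..<card (Ss l)} (Ss l)" for l
  proof -
    have "\<exists>\<tau>. bij_betw \<tau> {..<card (Ss l)} (Ss l)"
      using ex_bij_betw_nat_finite[OF finS[of l]] by (simp add: atLeast0LessThan)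
    then show ?thesis unfolding \<tau>_def by (rule someI_ex)
  qed
  define \<tau>' where "\<tau>' l = the_inv_into {..<card (Ss l)} (\<tau> l)" for l
  have \<tau>'lt: "\<tau>' l s < card (Ss l)" if "l \<in> G s" for l s
    using the_inv_into_into[of "\<tau> l" "{..<card (Ss l)}" s "{..<card (Ss l)}"] \<tau>[of l] that GS[OF that]
    by (auto simp: \<tau>'_def bij_betw_def Ss_def)
  have \<tau>\<tau>': "\<tau> l (\<tau>' l s) = s" if "l \<in> G s" for l s
    using f_the_inv_into_f_bij_betw[OF \<tau>[of l], of s] that GS[OF that]
    by (auto simp: \<tau>'_def Ss_def)
  \<comment> \<open>A missing subfile \<open>f\<close> of user \<open>l\<close> is sent by
    \<open>k = e \<sigma> l (f mod h)\<close> in its transmission number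
    \<open>\<tau>' k \<sigma>\<close>; \<open>decode\<close> subtracts the summands meant for users
    other than \<open>k\<close> and \<open>l\<close>.\<close>
  define s :: "'g d2d_scheme" where "s = \<lparr> num_users = K, num_files = N, subpack = h * F,
    memory = real N * real Z / real F,
    cache = (\<lambda>k. {(n, f). n < N \<and> f < h * F \<and> B (f div h) k = None}),
    num_coded = (\<lambda>k. card (Ss k)),
    transmit = (\<lambda>k d z i. \<Sum>l\<in>G (\<tau> k i) - {k}. z (d l, \<rho> (\<tau> k i) l * h + e' (\<tau> k i) l k)),
    decode = (\<lambda>l d z r f. case B (f div h) l of None \<Rightarrow> z (d l, f) | Some \<sigma> \<Rightarrow>
       r (e \<sigma> l (f mod h), \<tau>' (e \<sigma> l (f mod h)) \<sigma>) -
       (\<Sum>l'\<in>G \<sigma> - {e \<sigma> l (f mod h)} - {l}. z (d l', \<rho> \<sigma> l' * h + e' \<sigma> l' (e \<sigma> l (f mod h))))) \<rparr>"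
  \<comment> \<open>Needed with \<open>k'\<close> the sender, so that \<open>transmit\<close> reads
    only cached subfiles, and with \<open>k'\<close> a receiver, so that it can cancel the foreign
    summands.\<close>
  have incache: "(d l, \<rho> \<sigma> l * h + e' \<sigma> l k) \<in> cache s k'"
    if "d \<in> {..<K} \<rightarrow>\<^sub>E {..<N}" "l \<in> G \<sigma>" "k \<in> G \<sigma>" "k' \<in> G \<sigma>" "k \<noteq> l" "k' \<noteq> l" for d l \<sigma> k k'
  proof -
    have "(\<rho> \<sigma> l * h + e' \<sigma> l k) div h = \<rho> \<sigma> l" using e'lt[OF that(2,3,5)] by simp
    moreover have "\<rho> \<sigma> l * h + e' \<sigma> l k < h * F"
    proof -
      have "\<rho> \<sigma> l * h + e' \<sigma> l k < Suc (\<rho> \<sigma> l) * h" using e'lt[OF that(2,3,5)] by simp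
      also have "\<dots> \<le> F * h" using \<rho>[OF that(2)] by (intro mult_right_mono) auto
      finally show ?thesis by (simp add: mult.commute)
    qed
    ultimately show ?thesis
      using Gnone[OF that(2,4,6)] Gle[OF that(2)] that(1) by (auto simp: s_def)
  qed
  have dec: "decode s l d (cache_content s w l) (received s w d l) f = w (d l, f)"
    if d: "d \<in> {..<K} \<rightarrow>\<^sub>E {..<N}" and l: "l < K" and f: "f < h * F" for w d l f
  proof (cases "B (f div h) l")
    case None
    have "(d l, f) \<in> cache s l" using None d l f by (auto simp: s_def)
    then show ?thesis using None by (simp add: s_def cache_content_def)
  next
    case (Some \<sigma>)
    define k where "k = e \<sigma> l (f mod h)"
    have fF: "f div h < F" using f by (rule div_less_of_less_mult)
    have lG: "l \<in> G \<sigma>" using Some l fF by (auto simp: G_def)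
    have kG: "k \<in> G \<sigma>" "k \<noteq> l" using eG[OF lG, of "f mod h"] h by (auto simp: k_def)
    have \<rho>l: "\<rho> \<sigma> l = f div h" using \<rho>_eq fF l Some by auto
    have "e' \<sigma> l k = f mod h" using e'e[OF lG, of "f mod h"] h by (simp add: k_def)
    then have fl: "\<rho> \<sigma> l * h + e' \<sigma> l k = f" by (simp add: \<rho>l)
    define x where "x l' = w (d l', \<rho> \<sigma> l' * h + e' \<sigma> l' k)" for l'
    have "received s w d l (k, \<tau>' k \<sigma>) = transmit s k d (cache_content s w k) (\<tau>' k \<sigma>)"
      using Gle[OF kG(1)] kG(2) \<tau>'lt[OF kG(1)] by (simp add: received_def) (simp add: s_def)
    also have "\<dots> = (\<Sum>l'\<in>G \<sigma> - {k}. cache_content s w k (d l', \<rho> \<sigma> l' * h + e' \<sigma> l' k))"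
      by (simp add: s_def \<tau>\<tau>'[OF kG(1)])
    also have "\<dots> = (\<Sum>l'\<in>G \<sigma> - {k}. x l')"
      using kG incache[OF d] by (intro sum.cong refl) (auto simp: cache_content_def x_def)
    also have "\<dots> = x l + (\<Sum>l'\<in>G \<sigma> - {k} - {l}. x l')"
      using lG kG finG by (intro sum.remove) auto
    finally have 1: "received s w d l (k, \<tau>' k \<sigma>) = x l + (\<Sum>l'\<in>G \<sigma> - {k} - {l}. x l')" .
    have 2: "(\<Sum>l'\<in>G \<sigma> - {k} - {l}. cache_content s w l (d l', \<rho> \<sigma> l' * h + e' \<sigma> l' k))
      = (\<Sum>l'\<in>G \<sigma> - {k} - {l}. x l')"
      using kG lG incache[OF d] by (intro sum.cong refl) (auto simp: cache_content_def x_def)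
    have "decode s l d (cache_content s w l) (received s w d l) f
       = received s w d l (k, \<tau>' k \<sigma>) -
         (\<Sum>l'\<in>G \<sigma> - {k} - {l}. cache_content s w l (d l', \<rho> \<sigma> l' * h + e' \<sigma> l' k))"
      using Some by (simp add: s_def k_def)
    also have "\<dots> = x l" using 1 2 by simp
    also have "\<dots> = w (d l, f)" by (simp add: x_def fl)
    finally show ?thesis .
  qed
  have cch: "cache s l \<subseteq> {..<N} \<times> {..<h * F} \<and> real (card (cache s l)) \<le> memory s * real (h * F)"
    if l: "l < K" for l
  proof
    show "cache s l \<subseteq> {..<N} \<times> {..<h * F}" by (auto simp: s_def)
    let ?J = "{j\<in>{..<F}. B j l = None}"
    \<comment> \<open>\<open>memory\<close> only has to bound the cache size, so a covering by
      triples of a file, a starred row and a piece is enough.\<close>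
    have "cache s l \<subseteq> (\<lambda>(n, j, p). (n, j * h + p)) ` ({..<N} \<times> ?J \<times> {..<h})"
    proof
      fix u assume "u \<in> cache s l"
      then obtain n f where u: "u = (n, f)" "n < N" "f < h * F" "B (f div h) l = None"
        by (auto simp: s_def)
      have "u = (\<lambda>(n, j, p). (n, j * h + p)) (n, f div h, f mod h)" using u by simp
      moreover have "(n, f div h, f mod h) \<in> {..<N} \<times> ?J \<times> {..<h}"
        using u h div_less_of_less_mult[OF u(3)] by simp
      ultimately show "u \<in> (\<lambda>(n, j, p). (n, j * h + p)) ` ({..<N} \<times> ?J \<times> {..<h})" by blast
    qed
    then have "card (cache s l) \<le> card ({..<N} \<times> ?J \<times> {..<h})"
      by (rule surj_card_le[rotated]) auto
    also have "\<dots> = N * (Z * h)" using star[OF l] by (simp add: card_cartesian_product)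
    finally have "real (card (cache s l)) \<le> real (N * (Z * h))" by linarith
    also have "\<dots> = memory s * real (h * F)" using F by (simp add: s_def)
    finally show "real (card (cache s l)) \<le> memory s * real (h * F)" .
  qed
  have "is_d2d_scheme s"
    unfolding is_d2d_scheme_def using dec cch K N F h by (simp add: s_def)
  moreover have "cached_fraction s = real Z / real F"
    using N by (simp add: cached_fraction_def s_def)
  moreover have "d2d_rate s = real g / real (g - 1) * (real S / real F)"
  proof -
    \<comment> \<open>A user transmits once for each integer in its column, and each integer belongs
      to \<open>g\<close> users.\<close>
    have "(\<Sum>l<K. card (Ss l)) = (\<Sum>\<sigma>\<in>{1..S}. card {l\<in>{..<K}. l \<in> G \<sigma>})"
      unfolding Ss_def by (rule sum_card_swap) auto
    also have "\<dots> = (\<Sum>\<sigma>\<in>{1..S}. g)"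
    proof (intro sum.cong refl)
      fix \<sigma> assume "\<sigma> \<in> {1..S}"
      moreover have "{l\<in>{..<K}. l \<in> G \<sigma>} = G \<sigma>" using Gle by auto
      ultimately show "card {l\<in>{..<K}. l \<in> G \<sigma>} = g" using cardG by simp
    qed
    also have "\<dots> = S * g" by simp
    finally have "(\<Sum>l<K. real (card (Ss l))) = real S * real g"
      by (metis of_nat_mult of_nat_sum)
    then have "d2d_rate s = real S * real g / (real h * real F)"
      by (simp add: d2d_rate_def user_rate_def s_def flip: sum_divide_distrib)
    then show ?thesis by (simp add: h_def mult.commute)
  qed
  ultimately show ?thesis by (intro exI[of _ s]) (simp add: s_def h_def)
qed

text \<open>Carries arrays indexed by arbitrary sets, such as sets of subspaces, over to the
  numbered users and packets of a scheme.\<close>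

lemma is_regular_PDA_reindex:
  assumes reg: "is_regular_PDA g Rs Cs A K F Z S"
    and \<alpha>: "bij_betw \<alpha> Rs' Rs" and \<beta>: "bij_betw \<beta> Cs' Cs"
  shows "is_regular_PDA g Rs' Cs' (\<lambda>j l. A (\<alpha> j) (\<beta> l)) K F Z S"
proof -
  note pda = reg[unfolded is_regular_PDA_def is_PDA_def]
  have Z: "\<forall>l\<in>Cs. card {j\<in>Rs. A j l = None} = Z"
    and gs: "\<forall>s\<in>{1..S}. card {(j, l) \<in> Rs \<times> Cs. A j l = Some s} = g"
    and ent: "\<forall>j\<in>Rs. \<forall>l\<in>Cs. A j l \<in> insert None (Some ` {1..S})"
    and occ: "\<forall>s\<in>{1..S}. \<exists>j\<in>Rs. \<exists>l\<in>Cs. A j l = Some s"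
    using pda by - (elim conjE, assumption)+
  have Rs: "Rs = \<alpha> ` Rs'" and Cs: "Cs = \<beta> ` Cs'"
    and ir: "inj_on \<alpha> Rs'" and ic: "inj_on \<beta> Cs'"
    using \<alpha> \<beta> by (auto simp: bij_betw_def)
  have fin: "finite Rs'" "finite Cs'" "card Rs' = F" "card Cs' = K"
    using pda \<alpha> \<beta> by (auto simp: bij_betw_finite bij_betw_same_card)
  have stars: "card {j\<in>Rs'. A (\<alpha> j) (\<beta> l) = None} = Z" if "l \<in> Cs'" for l
  proof -
    have "{j\<in>Rs. A j (\<beta> l) = None} = \<alpha> ` {j\<in>Rs'. A (\<alpha> j) (\<beta> l) = None}"
      by (auto simp: Rs)
    moreover have "inj_on \<alpha> {j\<in>Rs'. A (\<alpha> j) (\<beta> l) = None}"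
      using ir by (rule inj_on_subset) auto
    moreover have "card {j\<in>Rs. A j (\<beta> l) = None} = Z" using Z that unfolding Cs by blast
    ultimately show ?thesis by (simp add: card_image)
  qed
  have reg: "card {(j, l) \<in> Rs' \<times> Cs'. A (\<alpha> j) (\<beta> l) = Some s} = g" if "s \<in> {1..S}" for s
  proof -
    have "{(j, l) \<in> Rs \<times> Cs. A j l = Some s} =
        map_prod \<alpha> \<beta> ` {(j, l) \<in> Rs' \<times> Cs'. A (\<alpha> j) (\<beta> l) = Some s}"
      by (auto simp: Rs Cs)
    moreover have "inj_on (map_prod \<alpha> \<beta>) {(j, l) \<in> Rs' \<times> Cs'. A (\<alpha> j) (\<beta> l) = Some s}"
      using map_prod_inj_on[OF ir ic] by (rule inj_on_subset) auto
    moreover have "card {(j, l) \<in> Rs \<times> Cs. A j l = Some s} = g" using gs that by blast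
    ultimately show ?thesis by (simp add: card_image)
  qed
  have pairs: "j1 \<noteq> j2 \<and> k1 \<noteq> k2 \<and> A (\<alpha> j1) (\<beta> k2) = None \<and> A (\<alpha> j2) (\<beta> k1) = None"
    if "j1 \<in> Rs'" "k1 \<in> Cs'" "j2 \<in> Rs'" "k2 \<in> Cs'" "(j1, k1) \<noteq> (j2, k2)"
      "A (\<alpha> j1) (\<beta> k1) = Some s" "A (\<alpha> j2) (\<beta> k2) = Some s" for j1 k1 j2 k2 s
  proof -
    have in_img: "\<alpha> j1 \<in> Rs" "\<beta> k1 \<in> Cs" "\<alpha> j2 \<in> Rs" "\<beta> k2 \<in> Cs"
      using that by (auto simp: Rs Cs)
    have "(\<alpha> j1, \<beta> k1) \<noteq> (\<alpha> j2, \<beta> k2)"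
      using that ir ic by (auto dest: inj_onD)
    moreover have same: "\<forall>j1\<in>Rs. \<forall>k1\<in>Cs. \<forall>j2\<in>Rs. \<forall>k2\<in>Cs. \<forall>s.
        (j1, k1) \<noteq> (j2, k2) \<and> A j1 k1 = Some s \<and> A j2 k2 = Some s \<longrightarrow>
        j1 \<noteq> j2 \<and> k1 \<noteq> k2 \<and> A j1 k2 = None \<and> A j2 k1 = None"
      using pda by (elim conjE)
    ultimately show ?thesis
      using same[rule_format, of "\<alpha> j1" "\<beta> k1" "\<alpha> j2" "\<beta> k2" s] in_img that(6,7)
      by (metis (no_types))
  qed
  show ?thesis
    unfolding is_regular_PDA_def is_PDA_def
  proof (intro conjI)
    show "\<forall>j\<in>Rs'. \<forall>l\<in>Cs'. A (\<alpha> j) (\<beta> l) \<in> insert None (Some ` {1..S})"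
      using ent unfolding Rs Cs by blast
    show "\<forall>s\<in>{1..S}. \<exists>j\<in>Rs'. \<exists>l\<in>Cs'. A (\<alpha> j) (\<beta> l) = Some s"
      using occ unfolding Rs Cs by blast
  qed (use fin stars reg pairs in \<open>blast+\<close>)
qed

lemma d2d_scheme_of_regular_PDA:
  assumes reg: "is_regular_PDA g Rs Cs A K F Z S"
    and "g \<ge> 2" and "F > 0" and "K > 0" and "N \<ge> 1"
  shows "\<exists>s :: 'g::ab_group_add d2d_scheme. is_d2d_scheme s \<and> num_files s = N \<and> num_users s = K \<and>
    cached_fraction s = real Z / real F \<and>
    d2d_rate s = real g / real (g - 1) * (real S / real F) \<and> subpack s = (g - 1) * F"
proof -
  have "finite Rs" "card Rs = F" "finite Cs" "card Cs = K"
    using reg by (auto simp: is_regular_PDA_def is_PDA_def)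
  then obtain \<alpha> \<beta> where "bij_betw \<alpha> {..<F} Rs" "bij_betw \<beta> {..<K} Cs"
    using ex_bij_betw_nat_finite[of Rs] ex_bij_betw_nat_finite[of Cs]
    by (auto simp: atLeast0LessThan)
  from is_regular_PDA_reindex[OF reg this] show ?thesis
    using assms(2-) by (rule d2d_scheme_of_nat_PDA)
qed

section \<open>Independence systems with uniform extension numbers\<close>

text \<open>Model of the caching line graph, to be used with \<open>a = 2\<close>,
  \<open>b = m + 1\<close> and independence modulo \<open>W\<close>.\<close>

definition line_verts :: "('b set \<Rightarrow> bool) \<Rightarrow> nat \<Rightarrow> nat \<Rightarrow> ('b set \<times> 'b set) set" where
  "line_verts indep a b = {(X, Y). indep (X \<union> Y) \<and> X \<inter> Y = {} \<and> card X = a \<and> card Y = b}"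

definition line_graph :: "('b set \<Rightarrow> bool) \<Rightarrow> nat \<Rightarrow> nat \<Rightarrow> ('b set \<times> 'b set) sgraph" where
  "line_graph indep a b = \<lparr> verts = line_verts indep a b,
     adj = (\<lambda>u v. u \<in> line_verts indep a b \<and> v \<in> line_verts indep a b \<and> u \<noteq> v \<and>
       (fst u = fst v \<or> snd u = snd v)) \<rparr>"

text \<open>For independent \<open>Z\<close> of size \<open>a + b\<close> these are the vertices
  with union \<open>Z\<close>; they form one clique and give one integer of the array.\<close>

definition splittings :: "nat \<Rightarrow> 'b set \<Rightarrow> ('b set \<times> 'b set) set" where
  "splittings a Z = (\<lambda>X. (X, Z - X)) ` {X. X \<subseteq> Z \<and> card X = a}"

definition splitting_classes :: "('b set \<Rightarrow> bool) \<Rightarrow> nat \<Rightarrow> nat \<Rightarrow> ('b set \<times> 'b set) set set" where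
  "splitting_classes indep a b = splittings a ` {Z. indep Z \<and> card Z = a + b}"

lemma verts_line_graph [simp]: "verts (line_graph indep a b) = line_verts indep a b"
  by (simp add: line_graph_def)

lemma card_splittings: "finite Z \<Longrightarrow> card (splittings a Z) = card Z choose a"
  unfolding splittings_def by (simp add: card_image inj_on_def n_subsets)

text \<open>The extension numbers \<open>p\<close> determine every count made below. They are
  real-valued because for points over \<open>W\<close> they arise as a quotient of differences of
  powers.\<close>

locale uniform_independence =
  fixes E :: "'b set" and indep :: "'b set \<Rightarrow> bool" and p :: "nat \<Rightarrow> real"
  assumes finite_ground: "finite E"
    and indep_subset_ground: "indep Z \<Longrightarrow> Z \<subseteq> E"
    and indep_empty: "indep {}"
    and indep_mono: "indep Z \<Longrightarrow> Z' \<subseteq> Z \<Longrightarrow> indep Z'"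
    and card_extensions: "indep Z \<Longrightarrow> real (card {v \<in> E - Z. indep (insert v Z)}) = p (card Z)"
begin

lemma finite_indep: "indep Z \<Longrightarrow> finite Z"
  using finite_ground indep_subset_ground finite_subset by blast

lemma finite_indeps: "finite {Z. indep Z \<and> Q Z}"
  using finite_ground indep_subset_ground by (auto intro: finite_subset[of _ "Pow E"])

text \<open>Double counting of the pairs \<open>(Z, v)\<close> with \<open>v \<in> Z - X\<close>.\<close>

lemma card_indep_supersets:
  assumes X: "indep X"
  shows "real (card {Z. indep Z \<and> X \<subseteq> Z \<and> card Z = card X + r}) * fact r = (\<Prod>i<r. p (card X + i))"
proof (induction r)
  case 0
  have "Z = X" if "indep Z" "X \<subseteq> Z" "card Z = card X" for Z
    using card_subset_eq[of Z X] finite_indep that by auto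
  then have "{Z. indep Z \<and> X \<subseteq> Z \<and> card Z = card X} = {X}" using X by blast
  then show ?case by simp
next
  case (Suc r)
  define \<A> where "\<A> j = {Z. indep Z \<and> X \<subseteq> Z \<and> card Z = card X + j}" for j
  define T where "T = (SIGMA Z:\<A> r. {v \<in> E - Z. indep (insert v Z)})"
  define T' where "T' = (SIGMA Z:\<A> (Suc r). Z - X)"
  have fin: "finite (\<A> j)" for j unfolding \<A>_def by (rule finite_indeps)
  have "bij_betw (\<lambda>(Z, v). (insert v Z, v)) T T'"
  proof (rule bij_betw_byWitness[where f' = "\<lambda>(Z, v). (Z - {v}, v)"])
    show "(\<lambda>(Z, v). (insert v Z, v)) ` T \<subseteq> T'"
      using finite_indep by (auto simp: T_def T'_def \<A>_def)
    show "(\<lambda>(Z, v). (Z - {v}, v)) ` T' \<subseteq> T"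
    proof clarify
      fix Z v assume "(Z, v) \<in> T'"
      then have *: "indep Z" "X \<subseteq> Z" "card Z = card X + Suc r" "v \<in> Z" "v \<notin> X"
        by (auto simp: T'_def \<A>_def)
      then have "insert v (Z - {v}) = Z" "indep (Z - {v})" "v \<in> E"
        using indep_mono[OF *(1)] indep_subset_ground by auto
      then show "(Z - {v}, v) \<in> T"
        using * finite_indep[OF *(1)] by (auto simp: T_def \<A>_def)
    qed
  qed (auto simp: T_def T'_def)
  then have "card T = card T'" by (rule bij_betw_same_card)
  moreover have "real (card T) = real (card (\<A> r)) * p (card X + r)"
  proof -
    have "card T = (\<Sum>Z\<in>\<A> r. card {v \<in> E - Z. indep (insert v Z)})"
      unfolding T_def using fin finite_ground by (intro card_SigmaI) auto
    then have "real (card T) = (\<Sum>Z\<in>\<A> r. real (card {v \<in> E - Z. indep (insert v Z)}))" by simp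
    also have "\<dots> = (\<Sum>Z\<in>\<A> r. p (card X + r))"
    proof (intro sum.cong refl)
      fix Z assume "Z \<in> \<A> r"
      then show "real (card {v \<in> E - Z. indep (insert v Z)}) = p (card X + r)"
        using card_extensions[of Z] by (simp add: \<A>_def)
    qed
    finally show ?thesis by simp
  qed
  moreover have "card T' = card (\<A> (Suc r)) * Suc r"
  proof -
    have "card T' = (\<Sum>Z\<in>\<A> (Suc r). card (Z - X))"
      unfolding T'_def by (intro card_SigmaI fin ballI) (auto simp: \<A>_def finite_indep)
    also have "\<dots> = (\<Sum>Z\<in>\<A> (Suc r). Suc r)"
      using finite_indep[OF X] by (intro sum.cong refl) (auto simp: \<A>_def card_Diff_subset)
    finally show ?thesis by simp
  qed
  ultimately have "real (card (\<A> (Suc r))) * real (Suc r) = real (card (\<A> r)) * p (card X + r)"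
    by (metis of_nat_mult)
  then have "real (card (\<A> (Suc r))) * fact (Suc r) = real (card (\<A> r)) * fact r * p (card X + r)"
    by (metis fact_Suc mult.assoc mult.commute)
  then show ?case using Suc by (simp add: \<A>_def)
qed

lemma card_indeps: "real (card {Z. indep Z \<and> card Z = r}) * fact r = (\<Prod>i<r. p i)"
  using card_indep_supersets[OF indep_empty, of r] by simp

section \<open>Splittings: cliques, partition and array\<close>

lemma line_vertsE:
  assumes "(X, Y) \<in> line_verts indep a b"
  obtains "indep (X \<union> Y)" "indep X" "indep Y" "finite X" "finite Y" "X \<inter> Y = {}" "card X = a" "card Y = b"
    "card (X \<union> Y) = a + b"
proof -
  have *: "indep (X \<union> Y)" "X \<inter> Y = {}" "card X = a" "card Y = b"
    using assms by (auto simp: line_verts_def)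
  then have "indep X" "indep Y" using indep_mono[OF *(1)] by auto
  then show ?thesis using that * finite_indep card_Un_disjoint by metis
qed

lemma splittings_iff:
  assumes "indep Z" "card Z = a + b"
  shows "(X, Y) \<in> splittings a Z \<longleftrightarrow> (X, Y) \<in> line_verts indep a b \<and> X \<union> Y = Z"
proof
  assume "(X, Y) \<in> splittings a Z"
  then have *: "X \<subseteq> Z" "card X = a" "Y = Z - X" by (auto simp: splittings_def)
  then have "X \<union> Y = Z" by auto
  moreover have "card Y = b"
    using * finite_indep[OF assms(1)] assms(2) by (simp add: card_Diff_subset finite_subset)
  ultimately show "(X, Y) \<in> line_verts indep a b \<and> X \<union> Y = Z"
    using * assms by (auto simp: line_verts_def)
next
  assume "(X, Y) \<in> line_verts indep a b \<and> X \<union> Y = Z"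
  then show "(X, Y) \<in> splittings a Z"
    by (auto simp: line_verts_def splittings_def image_iff)
qed

text \<open>Two distinct sets \<open>X\<close> and \<open>X'\<close> of the same finite size are not
  nested, so each meets the complement of the other in \<open>Z\<close>, and a mixed pair is not
  disjoint. This one fact yields both the cliques and the stars of the array.\<close>

lemma splittings_cross:
  assumes "finite Z" "(X, Y) \<in> splittings a Z" "(X', Y') \<in> splittings a Z" "(X, Y) \<noteq> (X', Y')"
  shows "X \<noteq> X'" "Y \<noteq> Y'" "(X, Y') \<notin> line_verts indep a b" "(X', Y) \<notin> line_verts indep a b"
proof -
  have *: "X \<subseteq> Z" "card X = a" "Y = Z - X" "X' \<subseteq> Z" "card X' = a" "Y' = Z - X'"
    using assms by (auto simp: splittings_def)
  then show 1: "X \<noteq> X'" using assms(4) by auto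
  then show "Y \<noteq> Y'" using * by auto
  have "finite X" "finite X'" using * assms(1) finite_subset by auto
  then have "\<not> X \<subseteq> X'" "\<not> X' \<subseteq> X" using 1 * card_subset_eq by metis+
  then show "(X, Y') \<notin> line_verts indep a b" "(X', Y) \<notin> line_verts indep a b"
    using * by (auto simp: line_verts_def)
qed

text \<open>Distinct splittings differ in both parts, so a common neighbour would share one part
  with each of them and be a mixed pair, which \<open>splittings_cross\<close> excludes.\<close>

lemma splittings_clique:
  assumes "indep Z" "card Z = a + b"
  shows "is_clique (complement_graph (square_graph (line_graph indep a b))) (splittings a Z)"
proof -
  have "\<not> adj (square_graph (line_graph indep a b)) u v"
    if uv: "u \<in> splittings a Z" "v \<in> splittings a Z" "u \<noteq> v" for u v
  proof -
    obtain X Y X' Y' where [simp]: "u = (X, Y)" "v = (X', Y')" by fastforce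
    note cross = splittings_cross[OF finite_indep[OF assms(1)] uv[unfolded \<open>u = (X, Y)\<close> \<open>v = (X', Y')\<close>]]
    have "\<not> (adj (line_graph indep a b) u w \<and> adj (line_graph indep a b) w v)" for w
      using cross by (cases w) (auto simp: line_graph_def)
    then show ?thesis using cross by (auto simp: square_graph_def line_graph_def)
  qed
  moreover have "splittings a Z \<subseteq> line_verts indep a b" using splittings_iff[OF assms] by auto
  ultimately show ?thesis
    by (auto simp: is_clique_def complement_graph_def square_graph_def line_graph_def)
qed

lemma splittings_nonempty:
  assumes "indep Z" "card Z = a + b"
  shows "splittings a Z \<noteq> {}"
proof -
  have "card (splittings a Z) > 0"
    using assms finite_indep by (simp add: card_splittings)
  then show ?thesis by auto
qed

text \<open>Any member of a class recovers \<open>Z\<close> as the union of its parts, so distinct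
  sets have distinct classes.\<close>

lemma card_splitting_classes: "card (splitting_classes indep a b) = card {Z. indep Z \<and> card Z = a + b}"
proof -
  have "inj_on (splittings a) {Z. indep Z \<and> card Z = a + b}"
  proof (intro inj_onI, clarify)
    fix Z Z' assume *: "splittings a Z = splittings a Z'" "indep Z" "card Z = a + b"
      "indep Z'" "card Z' = a + b"
    then obtain X Y where "(X, Y) \<in> splittings a Z" "(X, Y) \<in> splittings a Z'"
      using splittings_nonempty by fastforce
    then show "Z = Z'" using splittings_iff * by metis
  qed
  then show ?thesis by (simp add: splitting_classes_def card_image)
qed

text \<open>This form evaluates the definite description in \<open>clique_array\<close>, and it
  gives covering and disjointness of the classes.\<close>

lemma splitting_class_unique:
  assumes "(X, Y) \<in> line_verts indep a b"
  shows "C \<in> splitting_classes indep a b \<and> (X, Y) \<in> C \<longleftrightarrow> C = splittings a (X \<union> Y)"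
proof -
  have "indep (X \<union> Y)" "card (X \<union> Y) = a + b" using assms by (auto elim: line_vertsE)
  then show ?thesis using assms splittings_iff by (auto simp: splitting_classes_def)
qed

lemma partition_on_splitting_classes: "partition_on (line_verts indep a b) (splitting_classes indep a b)"
proof (rule partition_onI)
  show "\<Union> (splitting_classes indep a b) = line_verts indep a b"
  proof (intro subset_antisym subsetI)
    fix u assume "u \<in> \<Union> (splitting_classes indep a b)"
    then show "u \<in> line_verts indep a b"
      using splittings_iff by (cases u) (auto simp: splitting_classes_def)
  next
    fix u assume "u \<in> line_verts indep a b"
    then show "u \<in> \<Union> (splitting_classes indep a b)"
      using splitting_class_unique by (cases u) blast
  qed
next
  fix C C' assume C: "C \<in> splitting_classes indep a b" "C' \<in> splitting_classes indep a b" "C \<noteq> C'"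
  have "u \<in> line_verts indep a b" if "u \<in> C" for u
    using that C splittings_iff by (cases u) (auto simp: splitting_classes_def)
  then show "disjnt C C'"
    using C splitting_class_unique unfolding disjnt_iff by (metis surj_pair)
next
  show "{} \<notin> splitting_classes indep a b"
    using splittings_nonempty by (auto simp: splitting_classes_def)
qed

text \<open>\<open>Y\<close> corresponds to the independent superset \<open>X \<union> Y\<close> of
  \<open>X\<close>. Hence all columns contain equally many integers, and so equally many
  stars.\<close>

lemma card_opposite:
  assumes X: "indep X"
  shows "real (card {Y. (X, Y) \<in> line_verts indep (card X) b}) * fact b = (\<Prod>i<b. p (card X + i))"
proof -
  have "bij_betw (\<lambda>Y. X \<union> Y) {Y. (X, Y) \<in> line_verts indep (card X) b}
      {Z. indep Z \<and> X \<subseteq> Z \<and> card Z = card X + b}"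
  proof (rule bij_betw_byWitness[where f' = "\<lambda>Z. Z - X"])
    show "(\<lambda>Z. Z - X) ` {Z. indep Z \<and> X \<subseteq> Z \<and> card Z = card X + b}
        \<subseteq> {Y. (X, Y) \<in> line_verts indep (card X) b}"
      using X finite_indep by (auto simp: line_verts_def card_Diff_subset Un_absorb1)
    show "(\<union>) X ` {Y. (X, Y) \<in> line_verts indep (card X) b} \<subseteq>
        {Z. indep Z \<and> X \<subseteq> Z \<and> card Z = card X + b}"
      by (auto elim: line_vertsE)
  qed (auto simp: line_verts_def)
  then show ?thesis using card_indep_supersets[OF X, of b] by (simp add: bij_betw_same_card)
qed

lemma clique_array_splitting_classes:
  "clique_array (line_graph indep a b) (splitting_classes indep a b) lab Y X =
    (if (X, Y) \<in> line_verts indep a b then Some (lab (splittings a (X \<union> Y))) else None)"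
  using splitting_class_unique by (auto simp: clique_array_def)

text \<open>Equal labels mean equal unions, so two entries with the same integer are splittings of
  one set, and \<open>splittings_cross\<close> supplies the stars. Regularity holds because all
  classes have the same size.\<close>

lemma regular_PDA_splitting_classes:
  fixes a b :: nat and lab :: "('b set \<times> 'b set) set \<Rightarrow> nat"
  defines "Cs \<equiv> {X. indep X \<and> card X = a}"
  defines "Rs \<equiv> {Y. indep Y \<and> card Y = b}"
  assumes lab: "bij_betw lab (splitting_classes indep a b) {1..S}"
    and D: "\<And>X. X \<in> Cs \<Longrightarrow> card {Y. (X, Y) \<in> line_verts indep a b} = D"
  shows "is_regular_PDA ((a + b) choose a) Rs Cs
    (clique_array (line_graph indep a b) (splitting_classes indep a b) lab) (card Cs) (card Rs) (card Rs - D) S"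
proof -
  define A where "A = clique_array (line_graph indep a b) (splitting_classes indep a b) lab"
  have A: "A Y X = (if (X, Y) \<in> line_verts indep a b then Some (lab (splittings a (X \<union> Y))) else None)" for X Y
    unfolding A_def by (rule clique_array_splitting_classes)
  have fin: "finite Rs" "finite Cs" unfolding Rs_def Cs_def by (auto simp: finite_indeps)
  have verts: "Y \<in> Rs \<and> X \<in> Cs" if "(X, Y) \<in> line_verts indep a b" for X Y
    using that by (auto simp: Rs_def Cs_def elim: line_vertsE)
  have cls: "splittings a (X \<union> Y) \<in> splitting_classes indep a b" if "(X, Y) \<in> line_verts indep a b" for X Y
    using that splitting_class_unique by blast
  \<comment> \<open>The swap is there because the array takes the row \<open>Y\<close> first,
    whereas a vertex has the column \<open>X\<close> first.\<close>
  have fib: "{(Y, X) \<in> Rs \<times> Cs. A Y X = Some (lab C)} = prod.swap ` C"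
    if "C \<in> splitting_classes indep a b" for C
  proof -
    have "(X, Y) \<in> C \<longleftrightarrow> (X, Y) \<in> line_verts indep a b \<and> lab (splittings a (X \<union> Y)) = lab C" for X Y
    proof
      assume "(X, Y) \<in> C"
      moreover from this have "(X, Y) \<in> line_verts indep a b"
        using that partition_on_splitting_classes by (auto simp: partition_on_def)
      ultimately show "(X, Y) \<in> line_verts indep a b \<and> lab (splittings a (X \<union> Y)) = lab C"
        using splitting_class_unique that by metis
    next
      assume *: "(X, Y) \<in> line_verts indep a b \<and> lab (splittings a (X \<union> Y)) = lab C"
      then have "splittings a (X \<union> Y) = C"
        using lab that cls by (auto simp: bij_betw_def dest: inj_onD)
      then show "(X, Y) \<in> C" using splitting_class_unique * by metis
    qed
    then show ?thesis using verts by (auto simp: A split: if_splits)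
  qed
  have labE: "\<exists>C\<in>splitting_classes indep a b. s = lab C" if "s \<in> {1..S}" for s
    using lab that by (auto simp: bij_betw_def)
  have cC: "finite C \<and> card C = (a + b) choose a" if "C \<in> splitting_classes indep a b" for C
    using that finite_indep by (auto simp: splitting_classes_def card_splittings) (auto simp: splittings_def)
  show ?thesis
    unfolding is_regular_PDA_def is_PDA_def A_def[symmetric]
  proof (intro conjI ballI allI impI)
    fix Y X assume "Y \<in> Rs" "X \<in> Cs"
    show "A Y X \<in> insert None (Some ` {1..S})"
      using cls lab by (auto simp: A bij_betw_def)
  next
    fix X assume X: "X \<in> Cs"
    have "{Y \<in> Rs. A Y X = None} = Rs - {Y. (X, Y) \<in> line_verts indep a b}" by (auto simp: A)
    moreover have "{Y. (X, Y) \<in> line_verts indep a b} \<subseteq> Rs" using verts by auto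
    moreover from this have "card (Rs - {Y. (X, Y) \<in> line_verts indep a b}) = card Rs - D"
      using D[OF X] fin finite_subset by (subst card_Diff_subset) auto
    ultimately show "card {Y \<in> Rs. A Y X = None} = card Rs - D" by simp
  next
    fix s assume "s \<in> {1..S}"
    then obtain C where C: "C \<in> splitting_classes indep a b" "s = lab C" using labE by blast
    then have "C \<noteq> {}" using partition_on_splitting_classes unfolding partition_on_def by metis
    then obtain u where "u \<in> C" by blast
    then have "prod.swap u \<in> {(Y, X) \<in> Rs \<times> Cs. A Y X = Some s}"
      unfolding C(2) fib[OF C(1)] by blast
    then show "\<exists>j\<in>Rs. \<exists>k\<in>Cs. A j k = Some s" by auto
  next
    fix s assume "s \<in> {1..S}"
    then obtain C where C: "C \<in> splitting_classes indep a b" "s = lab C" using labE by blast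
    then show "card {(j, k). (j, k) \<in> Rs \<times> Cs \<and> A j k = Some s} = (a + b) choose a"
      using fib[OF C(1)] cC[OF C(1)] by (simp add: card_image)
  next
    fix Y1 X1 Y2 X2 s
    assume in1: "Y1 \<in> Rs" "X1 \<in> Cs" "Y2 \<in> Rs" "X2 \<in> Cs"
      and *: "(Y1, X1) \<noteq> (Y2, X2) \<and> A Y1 X1 = Some s \<and> A Y2 X2 = Some s"
    define Z where "Z = X1 \<union> Y1"
    have v: "(X1, Y1) \<in> line_verts indep a b" using * by (auto simp: A split: if_splits)
    then have Z: "indep Z" "card Z = a + b" by (auto simp: Z_def elim: line_vertsE)
    have CZ: "splittings a Z \<in> splitting_classes indep a b" using cls[OF v] by (simp add: Z_def)
    have "s = lab (splittings a Z)" using * v by (simp add: A Z_def)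
    then have "(Y1, X1) \<in> prod.swap ` splittings a Z" "(Y2, X2) \<in> prod.swap ` splittings a Z"
      using * in1 unfolding fib[OF CZ, symmetric] by simp_all
    then have "(X1, Y1) \<in> splittings a Z" "(X2, Y2) \<in> splittings a Z" by auto
    note cross = splittings_cross[OF finite_indep[OF Z(1)] this]
    show "Y1 \<noteq> Y2" "X1 \<noteq> X2" "A Y1 X2 = None" "A Y2 X1 = None"
      using cross * by (auto simp: A)
  qed (use fin in auto)
qed

end

section \<open>Independent points modulo a subspace\<close>

text \<open>Each new basis vector multiplies the size by the order of the field: in
  \<open>c *s x + y\<close> with \<open>y\<close> in the old span, \<open>c\<close> and
  \<open>y\<close> are unique, as otherwise dividing by \<open>c - c'\<close> would put
  \<open>x\<close> into the old span.\<close>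

lemma card_span_independent:
  fixes B :: "('a::{field,finite} ^ 'n::finite) set"
  assumes "finite B" "vec.independent B"
  shows "card (vec.span B) = CARD('a) ^ card B"
  using assms
proof (induction B rule: finite_induct)
  case (insert x B)
  have B: "vec.independent B" and x: "x \<notin> vec.span B"
    using insert.prems insert.hyps by (simp_all add: vec.independent_insert)
  let ?f = "\<lambda>(c, y). c *s x + y"
  have "vec.span (insert x B) = ?f ` (UNIV \<times> vec.span B)"
  proof (intro subset_antisym subsetI)
    fix v assume "v \<in> vec.span (insert x B)"
    then obtain c where "v - c *s x \<in> vec.span B" by (auto simp: vec.span_insert)
    then show "v \<in> ?f ` (UNIV \<times> vec.span B)"
      by (intro image_eqI[of _ _ "(c, v - c *s x)"]) auto
  next
    fix v assume "v \<in> ?f ` (UNIV \<times> vec.span B)"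
    then obtain c y where "v = c *s x + y" "y \<in> vec.span B" by auto
    then show "v \<in> vec.span (insert x B)" by (auto simp: vec.span_insert intro!: exI[of _ c])
  qed
  moreover have "inj_on ?f (UNIV \<times> vec.span B)"
  proof (rule inj_onI, clarify)
    fix c y c' y'
    assume y: "y \<in> vec.span B" "y' \<in> vec.span B" and eq: "c *s x + y = c' *s x + y'"
    then have "(c - c') *s x = y' - y" by (simp add: vec.scale_left_diff_distrib algebra_simps)
    then have "(c - c') *s x \<in> vec.span B" using y by (simp add: vec.span_diff)
    then have "inverse (c - c') *s ((c - c') *s x) \<in> vec.span B" by (rule vec.span_scale)
    then have "c = c'" using x by (cases "c = c'") (auto simp only: vec.scale_scale left_inverse
          right_minus_eq vec.scale_one simp_thms)
    then show "c = c' \<and> y = y'" using eq by simp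
  qed
  ultimately have "card (vec.span (insert x B)) = CARD('a) * card (vec.span B)"
    by (simp add: card_image card_cartesian_product)
  then show ?case using insert B by simp
qed simp

lemma card_subspace:
  fixes S :: "('a::{field,finite} ^ 'n::finite) set"
  assumes "vec.subspace S"
  shows "card S = CARD('a) ^ vec.dim S"
proof -
  obtain B where B: "B \<subseteq> S" "vec.independent B" "S \<subseteq> vec.span B" "card B = vec.dim S"
    using vec.basis_exists by blast
  then have "vec.span B = S" using assms vec.span_subspace by blast
  then show ?thesis using card_span_independent[of B] B by simp
qed

section \<open>Sums of subspaces as spans\<close>

lemma subspace_plus_eq_span:
  fixes S T :: "('a::field ^ 'n) set"
  assumes "vec.subspace S" "vec.subspace T"
  shows "S + T = vec.span (S \<union> T)"
proof -
  have "vec.span S = S" "vec.span T = T" using assms by (simp_all add: vec.span_eq_iff)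
  then have "vec.span (S \<union> T) = {x + y | x y. x \<in> S \<and> y \<in> T}"
    unfolding vec.span_Un by (simp only:)
  then show ?thesis
    by (auto simp: set_plus_def)
qed

lemma sum_subspaces_eq_span:
  fixes V :: "'i \<Rightarrow> ('a::field ^ 'n) set"
  assumes "finite I" "\<And>i. i \<in> I \<Longrightarrow> vec.subspace (V i)"
  shows "(\<Sum>i\<in>I. V i) = vec.span (\<Union>i\<in>I. V i)"
  using assms
proof (induction I rule: finite_induct)
  case (insert i I)
  have "vec.span (V i \<union> vec.span (\<Union>i\<in>I. V i)) = vec.span (V i \<union> (\<Union>i\<in>I. V i))"
    unfolding vec.span_eq
    by (auto intro: vec.span_base vec.span_mono[THEN subsetD, rotated])
  then show ?case using insert by (simp add: subspace_plus_eq_span)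
qed (simp add: set_zero)

text \<open>In the application \<open>w = t - 1\<close>, so \<open>points\<close> are the subspaces
  of dimension \<open>t\<close> above \<open>W\<close>, the points of the projective space of the
  quotient by \<open>W\<close>.\<close>

locale subspaces_over =
  fixes W :: "('a::{field,finite} ^ 'n::finite) set" and w :: nat
  assumes subspace_W: "vec.subspace W" and dim_W: "vec.dim W = w"
begin

abbreviation points :: "('a ^ 'n) set set" where
  "points \<equiv> subspaces_above W (Suc w)"

text \<open>Linear independence in the quotient by \<open>W\<close>. Including \<open>W\<close> in
  the union makes the empty set independent.\<close>

definition indep :: "('a ^ 'n) set set \<Rightarrow> bool" where
  "indep Z \<longleftrightarrow> Z \<subseteq> points \<and> vec.dim (W \<union> \<Union>Z) = w + card Z"

text \<open>A point is just one dimension above \<open>W\<close>, so each of its vectors outside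
  \<open>W\<close> generates it over \<open>W\<close>. Consequently distinct points meet only in
  \<open>W\<close>.\<close>

lemma point_eq_span:
  assumes v: "v \<in> points" and x: "x \<in> v" "x \<notin> W"
  shows "v = vec.span (insert x W)"
proof -
  have v': "vec.subspace v" "W \<subseteq> v" "vec.dim v = Suc w" using v by (auto simp: subspaces_above_def)
  have "x \<notin> vec.span W" using x subspace_W vec.span_eq_iff by metis
  then have "vec.dim (vec.span (insert x W)) = Suc w" by (simp add: vec.dim_insert dim_W)
  moreover have "vec.span (insert x W) \<subseteq> v" using v' x by (intro vec.span_minimal) auto
  ultimately show ?thesis
    using vec.subspace_dim_equal[of "vec.span (insert x W)" v] v' by simp
qed

lemma span_in_points:
  assumes "x \<notin> W"
  shows "vec.span (insert x W) \<in> points"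
proof -
  have "x \<notin> vec.span W" using assms subspace_W vec.span_eq_iff by metis
  then show ?thesis
    by (auto simp: subspaces_above_def vec.dim_insert dim_W intro: vec.span_base)
qed

lemma point_obtain:
  assumes "v \<in> points"
  obtains x where "x \<in> v" "x \<notin> W"
proof -
  have "vec.dim v = Suc w" using assms by (auto simp: subspaces_above_def)
  then have "\<not> v \<subseteq> W" using vec.dim_subset[of v W] dim_W by auto
  then show ?thesis using that by blast
qed

text \<open>Over \<open>W\<close> a point is generated by a single vector \<open>x\<close>, so
  adding the point changes the span just as adding \<open>x\<close> does.\<close>

lemma dim_insert_point:
  assumes v: "v \<in> points"
  shows "vec.dim (W \<union> \<Union>(insert v Z)) =
    (if v \<subseteq> vec.span (W \<union> \<Union>Z) then vec.dim (W \<union> \<Union>Z) else vec.dim (W \<union> \<Union>Z) + 1)"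
proof -
  let ?U = "W \<union> \<Union>Z"
  obtain x where x: "x \<in> v" "x \<notin> W" using v by (rule point_obtain)
  have veq: "v = vec.span (insert x W)" using point_eq_span[OF v x] .
  have "v \<subseteq> vec.span (insert x ?U)" unfolding veq by (rule vec.span_mono) auto
  then have "vec.span (W \<union> \<Union>(insert v Z)) = vec.span (insert x ?U)"
    unfolding vec.span_eq using x by (auto intro: vec.span_base)
  then have "vec.dim (W \<union> \<Union>(insert v Z)) = vec.dim (insert x ?U)" by (metis vec.dim_span)
  moreover have "v \<subseteq> vec.span ?U \<longleftrightarrow> x \<in> vec.span ?U"
  proof
    assume "x \<in> vec.span ?U"
    then have "insert x W \<subseteq> vec.span ?U" by (auto intro: vec.span_base)
    then show "v \<subseteq> vec.span ?U" unfolding veq by (intro vec.span_minimal) auto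
  qed (use x in auto)
  ultimately show ?thesis by (simp add: vec.dim_insert)
qed

lemma dim_Un_points_le:
  assumes "finite D" "D \<subseteq> points"
  shows "vec.dim (W \<union> \<Union>(Z \<union> D)) \<le> vec.dim (W \<union> \<Union>Z) + card D"
  using assms
proof (induction D rule: finite_induct)
  case (insert v D)
  then have v: "v \<in> points" by simp
  show ?case using insert dim_insert_point[OF v, of "Z \<union> D"] by (simp split: if_splits)
qed simp

lemma dim_points_le:
  assumes "Z \<subseteq> points"
  shows "vec.dim (W \<union> \<Union>Z) \<le> w + card Z"
  using dim_Un_points_le[of Z "{}"] assms by (simp add: dim_W)

text \<open>The removed points account for at most one dimension each, which leaves at least
  \<open>w + card Z'\<close> for the others.\<close>

lemma indep_subset:
  assumes "indep Z" "Z' \<subseteq> Z"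
  shows "indep Z'"
proof -
  have Z: "Z \<subseteq> points" "vec.dim (W \<union> \<Union>Z) = w + card Z" using assms(1) by (auto simp: indep_def)
  have "vec.dim (W \<union> \<Union>(Z' \<union> (Z - Z'))) \<le> vec.dim (W \<union> \<Union>Z') + card (Z - Z')"
    using Z by (intro dim_Un_points_le) auto
  moreover have "\<Union>(Z' \<union> (Z - Z')) = \<Union>Z" "card (Z - Z') = card Z - card Z'" "card Z' \<le> card Z"
    using assms(2) by (auto simp: card_Diff_subset card_mono)
  ultimately have "vec.dim (W \<union> \<Union>Z') \<ge> w + card Z'" using Z by simp
  then show ?thesis using dim_points_le[of Z'] assms(2) Z by (simp add: indep_def)
qed

text \<open>The sets \<open>v - W\<close>, for \<open>v\<close> a point contained in \<open>U\<close>, partition \<open>U - W\<close>.\<close>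

lemma card_points_in_subspace:
  assumes U: "vec.subspace U" "W \<subseteq> U"
  shows "real (card {v \<in> points. v \<subseteq> U}) * (real CARD('a) ^ Suc w - real CARD('a) ^ w) =
    real CARD('a) ^ vec.dim U - real CARD('a) ^ w"
proof -
  let ?Q = "{v \<in> points. v \<subseteq> U}"
  have diff: "real (card (V - W)) = real CARD('a) ^ vec.dim V - real CARD('a) ^ w"
    if "vec.subspace V" "W \<subseteq> V" for V
  proof -
    have "card (V - W) = card V - card W" "card W \<le> card V"
      using that by (auto simp: card_Diff_subset card_mono)
    then have "real (card (V - W)) = real (card V) - real (card W)" by simp
    then show ?thesis using card_subspace[OF that(1)] card_subspace[OF subspace_W] dim_W by simp
  qed
  have "U - W = (\<Union>v\<in>?Q. v - W)"
  proof (intro subset_antisym subsetI)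
    fix x assume x: "x \<in> U - W"
    have "vec.span (insert x W) \<subseteq> U" using x U by (intro vec.span_minimal) auto
    then have "vec.span (insert x W) \<in> ?Q" using x span_in_points by simp
    moreover have "x \<in> vec.span (insert x W) - W" using x by (auto intro: vec.span_base)
    ultimately show "x \<in> (\<Union>v\<in>?Q. v - W)" by blast
  qed auto
  then have "card (U - W) = (\<Sum>v\<in>?Q. card (v - W))"
  proof (simp only:, intro card_UN_disjoint ballI impI)
    fix v v' assume "v \<in> ?Q" "v' \<in> ?Q" "v \<noteq> v'"
    then show "(v - W) \<inter> (v' - W) = {}" using point_eq_span by blast
  qed auto
  then have "real (card (U - W)) = (\<Sum>v\<in>?Q. real (card (v - W)))" by simp
  also have "\<dots> = (\<Sum>v\<in>?Q. real CARD('a) ^ Suc w - real CARD('a) ^ w)"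
    using diff by (intro sum.cong refl) (auto simp: subspaces_above_def)
  finally show ?thesis using diff[OF U] by simp
qed

text \<open>A point extends \<open>Z\<close> exactly when it is not contained in the span of
  \<open>W\<close> and \<open>Z\<close>. The count is thus a difference of two instances of
  \<open>card_points_in_subspace\<close>, for the whole space and for that span.\<close>

lemma card_extensions_points:
  assumes Z: "indep Z"
  shows "real (card {v \<in> points - Z. indep (insert v Z)}) =
    (real CARD('a) ^ (CARD('n) - w) - real CARD('a) ^ card Z) / (real CARD('a) - 1)"
proof -
  let ?q = "real CARD('a)" and ?U = "vec.span (W \<union> \<Union>Z)"
  have Zp: "Z \<subseteq> points" and dZ: "vec.dim (W \<union> \<Union>Z) = w + card Z" using Z by (auto simp: indep_def)
  have q: "?q \<ge> 2"
    using card_mono[of "UNIV :: 'a set" "{0, 1}"] by simp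
  have "{v \<in> points - Z. indep (insert v Z)} = points - {v \<in> points. v \<subseteq> ?U}"
  proof (intro subset_antisym subsetI)
    fix v assume "v \<in> {v \<in> points - Z. indep (insert v Z)}"
    then have v: "v \<in> points" "v \<notin> Z" "indep (insert v Z)" by auto
    then have "vec.dim (W \<union> \<Union>(insert v Z)) = w + card Z + 1" by (simp add: indep_def)
    then show "v \<in> points - {v \<in> points. v \<subseteq> ?U}"
      using dim_insert_point[OF v(1), of Z] dZ v(1) by auto
  next
    fix v assume "v \<in> points - {v \<in> points. v \<subseteq> ?U}"
    then have v: "v \<in> points" "\<not> v \<subseteq> ?U" by auto
    moreover have "v \<notin> Z" using v(2) vec.span_superset[of "W \<union> \<Union>Z"] by blast
    ultimately show "v \<in> {v \<in> points - Z. indep (insert v Z)}"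
      using dim_insert_point[OF v(1), of Z] dZ Zp by (simp add: indep_def)
  qed
  moreover have "{v \<in> points. v \<subseteq> ?U} \<subseteq> points" by blast
  ultimately have card: "real (card {v \<in> points - Z. indep (insert v Z)}) =
      real (card {v \<in> points. v \<subseteq> UNIV}) - real (card {v \<in> points. v \<subseteq> ?U})"
    by (simp add: card_Diff_subset card_mono)
  have "W \<subseteq> ?U" by (auto intro: vec.span_base)
  from card_points_in_subspace[OF _ this] card_points_in_subspace[of UNIV]
  have "real (card {v \<in> points - Z. indep (insert v Z)}) * (?q ^ Suc w - ?q ^ w) =
      ?q ^ CARD('n) - ?q ^ (w + card Z)"
    unfolding card by (simp add: left_diff_distrib dZ card_cart_basis)
  \<comment> \<open>Splitting the exponent exposes the common factor \<open>?q ^ w\<close>, which is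
    then cancelled.\<close>
  also have "CARD('n) = w + (CARD('n) - w)"
    using vec.dim_subset_UNIV[of W] dim_W by (simp add: vec.dimension_def card_cart_basis)
  finally have "?q ^ w * (real (card {v \<in> points - Z. indep (insert v Z)}) * (?q - 1)) =
      ?q ^ w * (?q ^ (CARD('n) - w) - ?q ^ card Z)"
    by (simp add: power_add algebra_simps)
  then have "real (card {v \<in> points - Z. indep (insert v Z)}) * (?q - 1) =
      ?q ^ (CARD('n) - w) - ?q ^ card Z"
    by (rule mult_left_cancel[THEN iffD1, rotated]) (use q in simp)
  then show ?thesis using q by (simp add: eq_divide_eq)
qed

section \<open>The caching line graph in terms of independent sets of points\<close>

lemma uniform_independence_points: "uniform_independence points indep
  (\<lambda>r. (real CARD('a) ^ (CARD('n) - w) - real CARD('a) ^ r) / (real CARD('a) - 1))"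
proof
  show "indep {}" by (simp add: indep_def dim_W)
  show "Z \<subseteq> points" if "indep Z" for Z using that by (simp add: indep_def)
qed (auto simp only: finite indep_subset card_extensions_points)

text \<open>A nonempty sum of points contains \<open>W\<close> automatically, so only the dimension
  remains to be checked; the empty sum would be the zero subspace.\<close>

lemma sum_points_iff:
  assumes "finite I" "I \<noteq> {}" "\<And>i. i \<in> I \<Longrightarrow> V i \<in> points"
  shows "(\<Sum>i\<in>I. V i) \<in> subspaces_above W d \<longleftrightarrow> vec.dim (W \<union> \<Union>(V ` I)) = d"
proof -
  have V: "vec.subspace (V i)" "W \<subseteq> V i" if "i \<in> I" for i
    using assms(3)[OF that] by (auto simp: subspaces_above_def)
  have eq: "(\<Sum>i\<in>I. V i) = vec.span (\<Union>i\<in>I. V i)" using V assms(1) by (intro sum_subspaces_eq_span)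
  have W: "W \<subseteq> (\<Union>i\<in>I. V i)" using V assms(2) by blast
  then have "W \<union> \<Union>(V ` I) = (\<Union>i\<in>I. V i)" by blast
  moreover have "W \<subseteq> vec.span (\<Union>i\<in>I. V i)" using W vec.span_superset by blast
  ultimately show ?thesis unfolding eq by (simp add: subspaces_above_def)
qed

lemma set_X_eq: "set_X W (Suc w) = {X. indep X \<and> card X = 2}"
proof (intro subset_antisym subsetI)
  fix X assume "X \<in> set_X W (Suc w)"
  then obtain V1 V2 where X: "X = {V1, V2}" "V1 \<in> points" "V2 \<in> points"
    and s: "V1 + V2 \<in> subspaces_above W (Suc w + 1)"
    by (auto simp: set_X_def)
  \<comment> \<open>\<open>set_X\<close> does not ask for \<open>V1 \<noteq> V2\<close>, but
    \<open>V1 + V1 = V1\<close> has dimension \<open>w + 1\<close> instead of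
    \<open>w + 2\<close>.\<close>
  have "V1 + V1 = V1"
    using X subspace_plus_eq_span[of V1 V1] by (simp add: subspaces_above_def vec.span_eq_iff)
  then have ne: "V1 \<noteq> V2" using X s by (auto simp: subspaces_above_def)
  then have "(\<Sum>V\<in>X. V) \<in> subspaces_above W (w + 2)" using s X by simp
  then have "vec.dim (W \<union> \<Union>X) = w + 2"
    using sum_points_iff[of X "\<lambda>V. V" "w + 2"] X by auto
  then show "X \<in> {X. indep X \<and> card X = 2}" using X ne by (simp add: indep_def)
next
  fix X assume "X \<in> {X. indep X \<and> card X = 2}"
  then have X: "indep X" "card X = 2" by auto
  then obtain V1 V2 where V: "X = {V1, V2}" "V1 \<noteq> V2" by (auto simp: card_2_iff)
  have P: "V1 \<in> points" "V2 \<in> points" using X V by (auto simp: indep_def)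
  have "(\<Sum>V\<in>X. V) \<in> subspaces_above W (w + 2)"
    using sum_points_iff[of X "\<lambda>V. V" "w + 2"] X P V by (auto simp: indep_def)
  then show "X \<in> set_X W (Suc w)"
    using V P unfolding set_X_def by auto
qed

lemma set_Y_eq: "set_Y W m (Suc w) = {Y. indep Y \<and> card Y = m + 1}"
proof (intro subset_antisym subsetI)
  fix Y assume "Y \<in> set_Y W m (Suc w)"
  then obtain V where Y: "Y = V ` {1..m+1}" and V: "\<And>i. i \<in> {1..m+1} \<Longrightarrow> V i \<in> points"
    and s: "(\<Sum>i=1..m+1. V i) \<in> subspaces_above W (m + Suc w)"
    unfolding set_Y_def by blast
  have d: "vec.dim (W \<union> \<Union>Y) = w + (m + 1)"
    using sum_points_iff[of "{1..m+1}" V] V s by (simp add: Y)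
  have P: "Y \<subseteq> points" using V by (auto simp: Y)
  \<comment> \<open>The family \<open>V\<close> might repeat values; \<open>m + 1\<close> dimensions
    above \<open>W\<close> force \<open>m + 1\<close> distinct points.\<close>
  have "card Y \<le> m + 1" using card_image_le[of "{1..m+1}" V] by (simp add: Y)
  then show "Y \<in> {Y. indep Y \<and> card Y = m + 1}"
    using d P dim_points_le[OF P] by (simp add: indep_def)
next
  fix Y assume "Y \<in> {Y. indep Y \<and> card Y = m + 1}"
  then have Y: "Y \<subseteq> points" "vec.dim (W \<union> \<Union>Y) = w + (m + 1)" "card Y = m + 1"
    by (auto simp: indep_def)
  obtain V where V: "bij_betw V {1..m+1} Y"
    using ex_bij_betw_nat_finite_1[of Y] Y(3) by auto
  then have im: "V ` {1..m+1} = Y" by (simp add: bij_betw_def)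
  then have Vp: "V i \<in> points" if "i \<in> {1..m+1}" for i using Y(1) that by blast
  have "(\<Sum>i=1..m+1. V i) \<in> subspaces_above W (m + Suc w)"
    using sum_points_iff[of "{1..m+1}" V] Vp Y(2) im by simp
  then show "Y \<in> set_Y W m (Suc w)"
    unfolding set_Y_def using im Vp by blast
qed

lemma caching_line_graph_eq: "caching_line_graph W m (Suc w) = line_graph indep 2 (m + 1)"
proof -
  have "{(X, Y) \<in> set_X W (Suc w) \<times> set_Y W m (Suc w).
      (\<Sum>V\<in>X. V) + (\<Sum>V\<in>Y. V) \<in> subspaces_above W (m + Suc w + 2)} = line_verts indep 2 (m + 1)"
    (is "?L = ?R")
  proof -
    have key: "(\<Sum>V\<in>X. V) + (\<Sum>V\<in>Y. V) \<in> subspaces_above W (m + Suc w + 2) \<longleftrightarrow>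
        indep (X \<union> Y) \<and> X \<inter> Y = {}"
      if X: "indep X" "card X = 2" and Y: "indep Y" "card Y = m + 1" for X Y
    proof -
      have P: "X \<subseteq> points" "Y \<subseteq> points" using X Y by (auto simp: indep_def)
      have ne: "X \<noteq> {}" "Y \<noteq> {}" using X Y by auto
      have sub: "\<And>V. V \<in> X \<Longrightarrow> vec.subspace V" "\<And>V. V \<in> Y \<Longrightarrow> vec.subspace V"
        using P by (auto simp: subspaces_above_def)
      \<comment> \<open>Passing to spans makes the sum over \<open>X\<close> plus the sum over
        \<open>Y\<close> equal to the sum over \<open>X \<union> Y\<close> even when
        \<open>X\<close> and \<open>Y\<close> overlap.\<close>
      have "vec.span (vec.span (\<Union>X) \<union> vec.span (\<Union>Y)) = vec.span (\<Union>(X \<union> Y))"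
        unfolding vec.span_eq
        by (auto intro: vec.span_base vec.span_mono[THEN subsetD, rotated])
      then have "(\<Sum>V\<in>X. V) + (\<Sum>V\<in>Y. V) = (\<Sum>V\<in>X \<union> Y. V)"
        using sub sum_subspaces_eq_span[of X "\<lambda>V. V"] sum_subspaces_eq_span[of Y "\<lambda>V. V"]
          sum_subspaces_eq_span[of "X \<union> Y" "\<lambda>V. V"]
        by (subst (3) sum_subspaces_eq_span) (auto simp: subspace_plus_eq_span)
      then have "(\<Sum>V\<in>X. V) + (\<Sum>V\<in>Y. V) \<in> subspaces_above W (m + Suc w + 2) \<longleftrightarrow>
          vec.dim (W \<union> \<Union>(X \<union> Y)) = w + (m + 3)"
        using sum_points_iff[of "X \<union> Y" "\<lambda>V. V" "m + Suc w + 2"] P ne by (auto simp: add_ac eval_nat_numeral)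
      also have "\<dots> \<longleftrightarrow> indep (X \<union> Y) \<and> X \<inter> Y = {}"
      proof
        \<comment> \<open>The dimension above \<open>W\<close> is at most the number of points, so
          \<open>X \<union> Y\<close> has all \<open>m + 3\<close> points and nothing is left for
          the intersection.\<close>
        assume d: "vec.dim (W \<union> \<Union>(X \<union> Y)) = w + (m + 3)"
        have "card (X \<union> Y) + card (X \<inter> Y) = m + 3"
          using X Y card_Un_Int[of X Y] by simp
        moreover have "card (X \<union> Y) \<ge> m + 3" using dim_points_le[of "X \<union> Y"] P d by simp
        ultimately have "card (X \<union> Y) = m + 3" "card (X \<inter> Y) = 0" by linarith+
        then show "indep (X \<union> Y) \<and> X \<inter> Y = {}" using P d by (simp add: indep_def)
      next
        assume "indep (X \<union> Y) \<and> X \<inter> Y = {}"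
        then show "vec.dim (W \<union> \<Union>(X \<union> Y)) = w + (m + 3)"
          using X Y by (simp add: indep_def card_Un_disjoint)
      qed
      finally show ?thesis .
    qed
    show ?thesis
    proof (intro set_eqI, clarify)
      fix X Y
      show "(X, Y) \<in> ?L \<longleftrightarrow> (X, Y) \<in> ?R"
      proof
        assume "(X, Y) \<in> ?L"
        then show "(X, Y) \<in> ?R" using key[of X Y] by (simp add: set_X_eq set_Y_eq line_verts_def)
      next
        assume R: "(X, Y) \<in> ?R"
        then have "indep X \<and> indep Y \<and> card X = 2 \<and> card Y = m + 1 \<and> indep (X \<union> Y) \<and> X \<inter> Y = {}"
          by (auto elim: uniform_independence.line_vertsE[OF uniform_independence_points])
        then show "(X, Y) \<in> ?L" using key[of X Y] by (simp add: set_X_eq set_Y_eq)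
      qed
    qed
  qed
  then show ?thesis by (simp add: caching_line_graph_def line_graph_def Let_def)
qed

end

section \<open>The parameters\<close>

lemma prod_power_diff:
  fixes q :: real
  assumes "b \<le> a"
  shows "(\<Prod>i<b. q ^ a - q ^ i) = (\<Prod>i<b. q ^ i) * (\<Prod>i<b. q ^ (a - i) - 1)"
proof -
  have "(\<Prod>i<b. q ^ a - q ^ i) = (\<Prod>i<b. q ^ i * (q ^ (a - i) - 1))"
    using assms by (intro prod.cong refl) (simp add: algebra_simps flip: power_add)
  then show ?thesis by (simp add: prod.distrib)
qed

text \<open>The powers \<open>q ^ i\<close> factored out of both products agree and cancel. For a
  prime power \<open>q\<close> the products count the linearly independent \<open>b\<close>-tuples
  in dimensions \<open>b\<close> and \<open>a\<close>.\<close>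

lemma qbinom_times_prod:
  assumes "q \<ge> 2" "b \<le> a"
  shows "qbinom q a b * (\<Prod>i<b. real q ^ b - real q ^ i) = (\<Prod>i<b. real q ^ a - real q ^ i)"
proof -
  have "(\<Prod>i<b. real q ^ (b - i) - 1) \<noteq> 0"
  proof (subst prod_zero_iff, simp, clarsimp)
    fix i assume "i < b" "real q ^ (b - i) = 1"
    moreover have "1 < real q ^ (b - i)" using assms \<open>i < b\<close> by (intro one_less_power) auto
    ultimately show False by simp
  qed
  then show ?thesis
    unfolding prod_power_diff[OF assms(2)] prod_power_diff[OF order_refl] qbinom_def by simp
qed

lemma qbinom_one: "qbinom q a 1 = (real q ^ a - 1) / (real q - 1)"
  by (simp add: qbinom_def)

lemma power_diff_eq_qbinom:
  assumes "r \<le> n"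
  shows "(real q ^ n - real q ^ r) / (real q - 1) = real q ^ r * qbinom q (n - r) 1"
proof -
  have "real q ^ n = real q ^ r * real q ^ (n - r)" using assms by (simp flip: power_add)
  then show ?thesis by (simp only: qbinom_one) (simp add: right_diff_distrib)
qed

text \<open>Compares the product for the integers in a column, which starts at \<open>p 2\<close>,
  with the product for the rows, which starts at \<open>p 0\<close>.\<close>

lemma prod_split_first_last:
  fixes f :: "nat \<Rightarrow> 'b::comm_monoid_mult"
  shows "f 0 * f 1 * (\<Prod>i<b. f (2 + i)) = (\<Prod>i<b. f i) * (f b * f (b + 1))"
  by (induction b) (simp_all add: mult_ac)

section \<open>The parameters in terms of extension numbers\<close>

context uniform_independence
begin

text \<open>Columns, rows and integers are counted by the independent sets of sizes 2,
  \<open>b\<close> and \<open>b + 2\<close>. Counting the vertices in several ways links these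
  numbers and removes the long products from the fraction and the rate.\<close>

lemma d2d_scheme_line_graph:
  assumes b: "b \<ge> 1" and pos: "\<And>i. i < b + 2 \<Longrightarrow> p i > 0" and N: "N \<ge> 1"
  shows "\<exists>s :: 'g::ab_group_add d2d_scheme.
    corresponds_to_d2d (line_graph indep 2 b) {X. indep X \<and> card X = 2} {Y. indep Y \<and> card Y = b}
      ((b + 2) choose 2) s \<and>
    num_files s = N \<and>
    num_users s = card {X. indep X \<and> card X = 2} \<and>
    real (num_users s) = p 0 * p 1 / 2 \<and>
    real (subpack s) = real b * (real b + 3) / 2 * ((\<Prod>i<b. p i) / fact b) \<and>
    cached_fraction s = 1 - p b * p (b + 1) / (p 0 * p 1) \<and>
    d2d_rate s = p b * p (b + 1) / (real b * (real b + 3))"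
proof -
  define Cs where "Cs = {X. indep X \<and> card X = 2}"
  define Rs where "Rs = {Y. indep Y \<and> card Y = b}"
  define S where "S = card {Z. indep Z \<and> card Z = 2 + b}"
  define g where "g = (b + 2) choose 2"
  \<comment> \<open>\<open>card_opposite\<close> shows that the quotient is a natural number;
    defining \<open>D\<close> through it makes \<open>D\<close> the same for all columns.\<close>
  define D where "D = nat \<lfloor>(\<Prod>i<b. p (2 + i)) / fact b\<rfloor>"
  have p01: "p 0 > 0" "p 1 > 0" using pos b by auto
  have K: "real (card Cs) = p 0 * p 1 / 2"
    using card_indeps[of 2] by (simp add: Cs_def numeral_2_eq_2)
  have F: "real (card Rs) = (\<Prod>i<b. p i) / fact b"
    using card_indeps[of b] by (simp add: Rs_def eq_divide_eq)
  have "(\<Prod>i<b. p i) > 0" using pos by (intro prod_pos) auto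
  then have F0: "card Rs > 0"
    using F by (simp add: flip: of_nat_0_less_iff[where 'a = real])
  have K0: "card Cs > 0"
  proof -
    have "real (card Cs) > 0" unfolding K using p01 by simp
    then show ?thesis by simp
  qed
  have D: "card {Y. (X, Y) \<in> line_verts indep 2 b} = D" if "X \<in> Cs" for X
  proof -
    have "real (card {Y. (X, Y) \<in> line_verts indep 2 b}) = (\<Prod>i<b. p (2 + i)) / fact b"
      using card_opposite[of X b] that by (simp add: Cs_def eq_divide_eq)
    then show ?thesis unfolding D_def by (metis floor_of_nat nat_int)
  qed
  obtain X where X: "X \<in> Cs" using K0 by (metis card.empty all_not_in_conv less_irrefl)
  have Dfact: "real D * fact b = (\<Prod>i<b. p (2 + i))"
    using card_opposite[of X b] D[OF X] X by (simp add: Cs_def)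
  have Ffact: "real (card Rs) * fact b = (\<Prod>i<b. p i)"
    unfolding Rs_def by (rule card_indeps)
  \<comment> \<open>Both sides are twice the number of vertices, counted by columns and by
    rows.\<close>
  have DF: "p 0 * p 1 * real D = real (card Rs) * (p b * p (b + 1))"
  proof -
    have "p 0 * p 1 * real D * fact b = p 0 * p 1 * (\<Prod>i<b. p (2 + i))"
      unfolding Dfact[symmetric] by (simp only: mult_ac)
    also have "\<dots> = (\<Prod>i<b. p i) * (p b * p (b + 1))" by (rule prod_split_first_last)
    also have "\<dots> = real (card Rs) * (p b * p (b + 1)) * fact b"
      unfolding Ffact[symmetric] by (simp only: mult_ac)
    finally show ?thesis by simp
  qed
  \<comment> \<open>Again twice the number of vertices, now counted by cliques: there are
    \<open>S\<close> of them, of size \<open>(b + 2) * (b + 1) / 2\<close>.\<close>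
  have SF: "real S * (real b + 2) * (real b + 1) = real (card Rs) * (p b * p (b + 1))"
  proof -
    have "real S * (real b + 2) * (real b + 1) * fact b = real S * fact (2 + b)"
      by (simp add: algebra_simps)
    also have "\<dots> = (\<Prod>i<2 + b. p i)" unfolding S_def by (rule card_indeps)
    also have "\<dots> = (\<Prod>i<b. p i) * (p b * p (b + 1))" by (simp add: mult_ac)
    also have "\<dots> = real (card Rs) * (p b * p (b + 1)) * fact b"
      unfolding Ffact[symmetric] by (simp only: mult_ac)
    finally show ?thesis by simp
  qed
  \<comment> \<open>Ensures that the number of stars \<open>card Rs - D\<close> is a true difference
    and not truncated at 0.\<close>
  have D_le: "D \<le> card Rs"
  proof -
    have "{Y. (X, Y) \<in> line_verts indep 2 b} \<subseteq> Rs" by (auto simp: Rs_def elim: line_vertsE)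
    moreover have "finite Rs" unfolding Rs_def by (rule finite_indeps)
    ultimately show ?thesis using D[OF X] card_mono by blast
  qed
  have g2: "real g = (real b + 2) * (real b + 1) / 2"
  proof -
    have "even ((b + 2) * (b + 1))" by simp
    then have "2 * g = (b + 2) * (b + 1)" by (simp add: g_def choose_two)
    then have "real (2 * g) = real ((b + 2) * (b + 1))" by (rule arg_cong)
    then show ?thesis by (simp add: algebra_simps)
  qed
  have g: "g \<ge> 2"
  proof -
    have "(real b + 2) * (real b + 1) \<ge> 3 * 2" using b by (intro mult_mono) auto
    then have "real g \<ge> 2" using g2 by simp
    then show ?thesis by simp
  qed
  \<comment> \<open>For \<open>b = m + 1\<close> this is the factor
    \<open>(m + 1) * (m + 4) / 2\<close> of the subpacketization.\<close>
  have g1: "real (g - 1) = real b * (real b + 3) / 2"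
    using g g2 by (simp add: of_nat_diff field_simps)
  have "finite (splitting_classes indep 2 b)"
    using partition_on_splitting_classes finite_indeps by (simp add: splitting_classes_def)
  then obtain lab where lab: "bij_betw lab (splitting_classes indep 2 b) {1..S}"
    using finite_same_card_bij[of "splitting_classes indep 2 b" "{1..S}"] card_splitting_classes[of 2 b]
    by (auto simp: S_def)
  have reg: "is_regular_PDA g Rs Cs (clique_array (line_graph indep 2 b) (splitting_classes indep 2 b) lab)
      (card Cs) (card Rs) (card Rs - D) S"
    using regular_PDA_splitting_classes[OF lab] D by (simp add: g_def Rs_def Cs_def add.commute)
  obtain s :: "'g d2d_scheme" where s: "is_d2d_scheme s" "num_files s = N" "num_users s = card Cs"
    "cached_fraction s = real (card Rs - D) / real (card Rs)"
    "d2d_rate s = real g / real (g - 1) * (real S / real (card Rs))"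
    "subpack s = (g - 1) * card Rs"
    using d2d_scheme_of_regular_PDA[OF reg g F0 K0 N] by blast
  have "is_clique (complement_graph (square_graph (line_graph indep 2 b))) C \<and> card C = g"
    if "C \<in> splitting_classes indep 2 b" for C
    using that finite_indep splittings_clique
    by (auto simp: splitting_classes_def card_splittings g_def add.commute)
  then have "corresponds_to_d2d (line_graph indep 2 b) Cs Rs g s"
    unfolding corresponds_to_d2d_def using s g reg lab partition_on_splitting_classes[of 2 b]
    by (intro conjI exI[of _ "splitting_classes indep 2 b"] exI[of _ lab] exI[of _ "card Cs"]
        exI[of _ "card Rs"] exI[of _ "card Rs - D"] exI[of _ S]) (simp_all only: verts_line_graph, blast)
  moreover have "cached_fraction s = 1 - p b * p (b + 1) / (p 0 * p 1)"
    using DF F0 p01 D_le by (simp add: s of_nat_diff field_simps)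
  moreover have "d2d_rate s = p b * p (b + 1) / (real b * (real b + 3))"
  proof -
    have "d2d_rate s = (real S * (real b + 2) * (real b + 1)) / (real b * (real b + 3) * real (card Rs))"
      unfolding s(5) g1 g2 by (simp add: mult_ac)
    then show ?thesis unfolding SF using F0 by simp
  qed
  moreover have "real (subpack s) = real b * (real b + 3) / 2 * ((\<Prod>i<b. p i) / fact b)"
    unfolding s(6) of_nat_mult g1 F ..
  moreover have "real (num_users s) = p 0 * p 1 / 2" unfolding s(3) by (rule K)
  ultimately show ?thesis
    using s(2,3) unfolding Cs_def[symmetric] Rs_def[symmetric] g_def[symmetric] by blast
qed

end

section \<open>Specialization to the caching line graph of \<open>W\<close>\<close>

theorem theorem2:
  fixes W :: "('a::{field,finite} ^ 'n::finite) set"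
    and q k m t N :: nat
  assumes "CARD('a) = q" and "CARD('n) = k"
    and "m \<ge> 1" and "t \<ge> 1" and "m + t + 2 \<le> k"
    and "vec.subspace W" and "vec.dim W = t - 1"
    and "N \<ge> 1"
  shows "\<exists>s :: 'g::ab_group_add d2d_scheme.
    corresponds_to_d2d (caching_line_graph W m t) (set_X W t) (set_Y W m t) ((m + 3) choose 2) s \<and>
    num_files s = N \<and>
    num_users s = card (set_X W t) \<and>
    real (num_users s) = real q / 2 * qbinom q (k - t + 1) 1 * qbinom q (k - t) 1 \<and>
    real (subpack s) =
      (real m + 1) * (real m + 4) / 2 * qbinom q (k - t + 1) (m + 1) *
      ((\<Prod>i=0..m. real q ^ (m + 1) - real q ^ i) / (fact (m + 1) * (real q - 1) ^ (m + 1))) \<and>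
    cached_fraction s =
      1 - real q ^ (2 * (m + 1)) *
        ((qbinom q (k - m - t) 1 * qbinom q (k - m - t - 1) 1) /
         (qbinom q (k - t + 1) 1 * qbinom q (k - t) 1)) \<and>
    d2d_rate s =
      real q ^ (2 * m + 3) / ((real m + 1) * (real m + 4)) *
      qbinom q (k - m - t) 1 * qbinom q (k - m - t - 1) 1"
proof -
  \<comment> \<open>\<open>n\<close> is the dimension of the quotient by \<open>W\<close>, since
    \<open>W\<close> has dimension \<open>t - 1\<close>.\<close>
  define n where "n = k - t + 1"
  define w where "w = t - 1"
  have t: "t = Suc w" and n: "CARD('n) - w = n"
    using assms by (auto simp: n_def w_def)
  have q: "q \<ge> 2"
    using card_mono[of "UNIV :: 'a set" "{0, 1}"] assms(1) by simp
  have W: "subspaces_over W w" using assms by unfold_locales (auto simp: w_def)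
  let ?I = "subspaces_over.indep W w"
  define p where
    "p = (\<lambda>r. (real CARD('a) ^ (CARD('n) - w) - real CARD('a) ^ r) / (real CARD('a) - 1))"
  have indep: "uniform_independence (subspaces_above W (Suc w)) ?I p"
    unfolding p_def by (rule subspaces_over.uniform_independence_points[OF W])
  have p_eq: "p r = (real q ^ n - real q ^ r) / (real q - 1)" for r
    by (simp only: p_def n assms(1))
  have eqs: "set_X W t = {X. ?I X \<and> card X = 2}" "set_Y W m t = {Y. ?I Y \<and> card Y = m + 1}"
    "caching_line_graph W m t = line_graph ?I 2 (m + 1)"
    unfolding t by (rule subspaces_over.set_X_eq[OF W] subspaces_over.set_Y_eq[OF W]
        subspaces_over.caching_line_graph_eq[OF W])+
  \<comment> \<open>This is where \<open>m + t + 2 \<le> k\<close> enters: it says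
    \<open>m + 3 \<le> n\<close>, so independent sets of \<open>m + 3\<close> points exist.\<close>
  have pos: "p i > 0" if "i < m + 1 + 2" for i
  proof -
    have "real q ^ i < real q ^ n"
      using that q assms(5) by (intro power_strict_increasing) (auto simp: n_def)
    then show ?thesis using q by (simp add: p_eq)
  qed
  have p: "p 0 = qbinom q (k - t + 1) 1" "p 1 = real q * qbinom q (k - t) 1"
    "p (m + 1) = real q ^ (m + 1) * qbinom q (k - m - t) 1"
    "p (m + 2) = real q ^ (m + 2) * qbinom q (k - m - t - 1) 1"
  proof -
    have "p r = real q ^ r * qbinom q (n - r) 1" if "r \<le> n" for r
      unfolding p_eq using that by (rule power_diff_eq_qbinom)
    from this[of 0] this[of 1] this[of "m + 1"] this[of "m + 2"]
    show "p 0 = qbinom q (k - t + 1) 1" "p 1 = real q * qbinom q (k - t) 1"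
      "p (m + 1) = real q ^ (m + 1) * qbinom q (k - m - t) 1"
      "p (m + 2) = real q ^ (m + 2) * qbinom q (k - m - t - 1) 1"
      using assms(5) by (simp_all add: n_def diff_diff_left add_ac)
  qed
  \<comment> \<open>Dividing by \<open>fact (m + 1)\<close> turns this into the number of
    rows.\<close>
  have prods: "(\<Prod>i<m+1. p i) = qbinom q (k - t + 1) (m + 1) *
      ((\<Prod>i=0..m. real q ^ (m + 1) - real q ^ i) / (real q - 1) ^ (m + 1))"
  proof -
    have "(\<Prod>i<m+1. p i) = (\<Prod>i<m+1. real q ^ n - real q ^ i) / (real q - 1) ^ (m + 1)"
      by (simp add: p_eq prod_dividef del: prod.lessThan_Suc)
    also have "(\<Prod>i<m+1. real q ^ n - real q ^ i) =
        qbinom q n (m + 1) * (\<Prod>i<m+1. real q ^ (m + 1) - real q ^ i)"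
      using q assms(5) by (intro qbinom_times_prod[symmetric]) (auto simp: n_def)
    finally have "(\<Prod>i<m+1. p i) = qbinom q n (m + 1) *
        (\<Prod>i<m+1. real q ^ (m + 1) - real q ^ i) / (real q - 1) ^ (m + 1)" .
    moreover have "{..<m+1} = {0..m}" by auto
    ultimately show ?thesis by (simp only: n_def times_divide_eq_right)
  qed
  obtain s :: "'g d2d_scheme" where s:
    "corresponds_to_d2d (caching_line_graph W m t) (set_X W t) (set_Y W m t) ((m + 1 + 2) choose 2) s"
    "num_files s = N" "num_users s = card (set_X W t)" "real (num_users s) = p 0 * p 1 / 2"
    "real (subpack s) = real (m + 1) * (real (m + 1) + 3) / 2 * ((\<Prod>i<m+1. p i) / fact (m + 1))"
    "cached_fraction s = 1 - p (m + 1) * p (m + 1 + 1) / (p 0 * p 1)"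
    "d2d_rate s = p (m + 1) * p (m + 1 + 1) / (real (m + 1) * (real (m + 1) + 3))"
    using uniform_independence.d2d_scheme_line_graph[OF indep, of "m + 1" N] pos assms(8) unfolding eqs by force
  have "real (num_users s) = real q / 2 * qbinom q (k - t + 1) 1 * qbinom q (k - t) 1"
    unfolding s(4) p by simp
  moreover have "real (subpack s) =
      (real m + 1) * (real m + 4) / 2 * qbinom q (k - t + 1) (m + 1) *
      ((\<Prod>i=0..m. real q ^ (m + 1) - real q ^ i) / (fact (m + 1) * (real q - 1) ^ (m + 1)))"
    unfolding s(5) prods by (simp add: add_ac mult_ac)
  moreover have "cached_fraction s =
      1 - real q ^ (2 * (m + 1)) *
        ((qbinom q (k - m - t) 1 * qbinom q (k - m - t - 1) 1) /
         (qbinom q (k - t + 1) 1 * qbinom q (k - t) 1))"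
  proof -
    \<comment> \<open>\<open>p 1\<close> in the denominator carries a factor \<open>q\<close>, which
      lowers the exponent \<open>2 * m + 3\<close> to \<open>2 * (m + 1)\<close>.\<close>
    have "(m + 1) + (m + 2) = Suc (2 * (m + 1))" by simp
    then have "real q ^ (m + 1) * real q ^ (m + 2) = real q * real q ^ (2 * (m + 1))"
      by (simp only: flip: power_add power_Suc)
    moreover have "m + 1 + 1 = m + 2" by simp
    ultimately show ?thesis unfolding s(6) using q by (simp only: p) (simp add: field_simps)
  qed
  moreover have "d2d_rate s =
      real q ^ (2 * m + 3) / ((real m + 1) * (real m + 4)) *
      qbinom q (k - m - t) 1 * qbinom q (k - m - t - 1) 1"
  proof -
    have "(m + 1) + (m + 2) = 2 * m + 3" by simp
    then have "real q ^ (m + 1) * real q ^ (m + 2) = real q ^ (2 * m + 3)"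
      by (simp only: flip: power_add)
    moreover have "m + 1 + 1 = m + 2" "real (m + 1) * (real (m + 1) + 3) = (real m + 1) * (real m + 4)"
      by (simp_all add: add_ac)
    ultimately show ?thesis unfolding s(7) by (simp only: p) (simp add: field_simps)
  qed
  moreover have "m + 1 + 2 = m + 3" by simp
  ultimately show ?thesis using s(1-3) by (intro exI[of _ s]) (simp only: simp_thms)
qed

end
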